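(* Suppose $n$ sensor nodes are deployed independently and uniformly at random in a cube of volume $V$ in $\mathbb{R}^3$, with common transmission range $$r_{\mathrm{Trans}}=\sqrt[3]{\frac{3(1+\ell)\ln n\, V}{4\pi n}},\qquad \ell>11/5,$$ and two nodes adjacent iff their distance is at most $r_{\mathrm{Trans}}$. Let $D$ be the hop-diameter of the resulting network. Then $$\lim_{n\to\infty}\Pr\left[D\le 12\sqrt[3]{\frac{\pi n}{6(1+\ell)\ln n}}\right]=1.$$
   Context: The hop distance between two nodes is the number of edges in a shortest path between them; the hop-diameter is the maximum hop distance over all pairs of nodes. Asymptotics are as $n\to\infty$ with $V=V(n)$ growing so that $n/V\to\rho$ for a constant $\rho$. *)

theory Defs
  imports "HOL-Probability.Probability"
begin

definition rgg_adj :: "(nat \<Rightarrow> real^3) \<Rightarrow> real \<Rightarrow> nat \<Rightarrow> nat \<Rightarrow> bool" where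
  "rgg_adj p r i j \<longleftrightarrow> i \<noteq> j \<and> dist (p i) (p j) \<le> r"

definition rgg_walk :: "nat \<Rightarrow> (nat \<Rightarrow> real^3) \<Rightarrow> real \<Rightarrow> nat \<Rightarrow> nat \<Rightarrow> nat \<Rightarrow> bool" where
  "rgg_walk n p r i j k \<longleftrightarrow> (\<exists>xs. length xs = Suc k \<and> hd xs = i \<and> last xs = j \<and>
      set xs \<subseteq> {..<n} \<and> (\<forall>m < k. rgg_adj p r (xs ! m) (xs ! Suc m)))"

text \<open>Hop distance (infinite if no path exists).\<close>
definition hop_dist :: "nat \<Rightarrow> (nat \<Rightarrow> real^3) \<Rightarrow> real \<Rightarrow> nat \<Rightarrow> nat \<Rightarrow> enat" where
  "hop_dist n p r i j = (INF k \<in> {k. rgg_walk n p r i j k}. enat k)"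

definition hop_diameter :: "nat \<Rightarrow> (nat \<Rightarrow> real^3) \<Rightarrow> real \<Rightarrow> enat" where
  "hop_diameter n p r = (SUP i \<in> {..<n}. SUP j \<in> {..<n}. hop_dist n p r i j)"

definition cube :: "real \<Rightarrow> (real^3) set" where
  "cube V = cbox 0 (\<chi> _. root 3 V)"

definition sensor_space :: "nat \<Rightarrow> real \<Rightarrow> (nat \<Rightarrow> real^3) measure" where
  "sensor_space n V = PiM {..<n} (\<lambda>_. uniform_measure lborel (cube V))"

definition r_trans :: "real \<Rightarrow> nat \<Rightarrow> real \<Rightarrow> real" where
  "r_trans l n V = root 3 (3 * (1 + l) * ln (real n) * V / (4 * pi * real n))"

end

theory Submission
  imports Defs "HOL-Real_Asymp.Real_Asymp"
begin

text \<open>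
  Cut the cube into \<open>N ^ 3\<close> cells, \<open>N\<close> being of order \<open>root 3 (n / ln n)\<close> with a large constant, so that
  the range \<open>R\<close>, measured in cell sides, is a large constant too. By a union bound, with high
  probability every bounded neighbourhood contains only a bounded number of empty cells, and the
  total volume of these is less than what a node's range contains in directions that lead towards
  the centre. Hence every node has a neighbour closer to the centre, by at least one cell side.
  Usually much more is gained: if the cell at distance \<open>R - 2\<close> on the segment to the centre is occupied,
  a hop gains \<open>R - 4\<close>, and this fails only boundedly often in any bounded number of
  consecutive hops. So half of all hops gain \<open>R - 4\<close>, every node reaches the centre in about
  \<open>2 * N / R\<close> hops, and the diameter is at most \<open>5 * N / R + O(1)\<close>, while the claimed bound equals
  \<open>6 * N / R\<close>.
\<close>

section \<open>Wedges of balls\<close>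

definition flip :: "3 set \<Rightarrow> real^3 \<Rightarrow> real^3" where
  "flip A v = (\<chi> i. if i \<in> A then - v $ i else v $ i)"

lemma flip_nth [simp]: "flip A v $ i = (if i \<in> A then - v $ i else v $ i)"
  by (simp add: flip_def)

lemma flip_flip [simp]: "flip A (flip A v) = v"
  by (simp add: vec_eq_iff)

lemma norm_flip [simp]: "norm (flip A v) = norm v"
  unfolding norm_vec_def by (rule L2_set_cong) auto

lemma orthogonal_flip: "orthogonal_transformation (flip A)"
proof -
  have "linear (flip A)"
    by (rule linearI) (auto simp: vec_eq_iff)
  then show ?thesis
    by (simp add: orthogonal_transformation)
qed

text \<open>The reflection carries the part of \<open>S\<close> where \<open>f\<close> is negative
  into the other part, so \<open>S\<close> is covered by that other part and its mirror image, which
  have equal volume.\<close>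

lemma halfspace_measure_ge_half:
  fixes S :: "(real^3) set"
  assumes S: "S \<in> lmeasurable" and "S \<inter> {v. 0 \<le> f v} \<in> lmeasurable"
    and sym: "\<And>v. v \<in> S \<Longrightarrow> flip A v \<in> S" and odd: "\<And>v. f (flip A v) = - f v"
  shows "measure lebesgue S \<le> 2 * measure lebesgue (S \<inter> {v. (0::real) \<le> f v})"
proof -
  let ?T = "S \<inter> {v. 0 \<le> f v}"
  have "S \<subseteq> ?T \<union> flip A ` ?T"
  proof
    fix v assume v: "v \<in> S"
    show "v \<in> ?T \<union> flip A ` ?T"
    proof (cases "0 \<le> f v")
      case False
      then have "flip A v \<in> ?T" using v sym odd by auto
      then have "flip A (flip A v) \<in> flip A ` ?T" by blast
      then show ?thesis by simp
    qed (use v in auto)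
  qed
  moreover have T: "flip A ` ?T \<in> lmeasurable"
    using measurable_orthogonal_image[OF orthogonal_flip] assms(2) by blast
  ultimately have "measure lebesgue S \<le> measure lebesgue (?T \<union> flip A ` ?T)"
    using assms(2) S by (intro measure_mono_fmeasurable) auto
  also have "\<dots> \<le> measure lebesgue ?T + measure lebesgue (flip A ` ?T)"
    using assms(2) T by (intro measure_Un_le) auto
  also have "measure lebesgue (flip A ` ?T) = measure lebesgue ?T"
    using measure_orthogonal_image[OF orthogonal_flip] assms(2) by blast
  finally show ?thesis by simp
qed

text \<open>One halving per coordinate: cutting \<open>S\<close> by the sign condition at
  \<open>j\<close> leaves it invariant under the reflections in the other coordinates, so the
  induction continues.\<close>

lemma orthant_measure_ge:
  fixes S :: "(real^3) set" and a :: "real^3"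
  assumes "S \<in> sets borel" "bounded S"
    and "\<And>j v. j \<in> J \<Longrightarrow> v \<in> S \<Longrightarrow> flip {j} v \<in> S"
  shows "measure lebesgue S \<le> 2 ^ card J * measure lebesgue (S \<inter> {v. \<forall>j\<in>J. 0 \<le> v $ j * a $ j})"
proof -
  have "finite J" by simp
  then show ?thesis using assms
  proof (induction J arbitrary: S rule: finite_induct)
    case empty
    then show ?case by simp
  next
    case (insert j J)
    let ?S = "S \<inter> {v. 0 \<le> v $ j * a $ j}"
    have "{v::real^3. 0 \<le> v $ j * a $ j} \<in> sets borel" by measurable
    then have S: "?S \<in> sets borel" using insert.prems by auto
    have b: "bounded ?S" using insert.prems by (auto intro: bounded_subset)
    have "measure lebesgue S \<le> 2 * measure lebesgue ?S"
      using insert.prems b S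
      by (intro halfspace_measure_ge_half[where A = "{j}"]) (auto intro!: bounded_set_imp_lmeasurable)
    also have "measure lebesgue ?S \<le> 2 ^ card J * measure lebesgue (?S \<inter> {v. \<forall>j\<in>J. 0 \<le> v $ j * a $ j})"
      using insert.prems S b insert.hyps by (intro insert.IH) auto
    also have "?S \<inter> {v. \<forall>j\<in>J. 0 \<le> v $ j * a $ j} = S \<inter> {v. \<forall>j\<in>insert j J. 0 \<le> v $ j * a $ j}"
      by auto
    finally show ?case using insert.hyps by simp
  qed
qed

text \<open>Reflecting all coordinates outside \<open>J\<close> at once negates the sum and costs
  one factor 2; each coordinate in \<open>J\<close> costs another, as its reflection leaves that sum
  alone. In \<open>weak_step\<close> the vector \<open>a\<close> points to the centre: the sign
  conditions keep the wedge away from nearby faces, and with the sum they make its inner product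
  with \<open>a\<close> nonnegative.\<close>

lemma ball_wedge_measure_ge:
  fixes a :: "real^3" and r :: real and J :: "3 set"
  assumes "0 \<le> r"
  defines "W \<equiv> {v. norm v \<le> r \<and> (\<forall>j\<in>J. 0 \<le> v $ j * a $ j) \<and> 0 \<le> (\<Sum>j\<in>-J. v $ j * a $ j)}"
  shows "W \<in> lmeasurable" "4 / 3 * pi * r ^ 3 \<le> 2 * 2 ^ card J * measure lebesgue W"
proof -
  let ?B = "cball (0::real^3) r"
  let ?S = "?B \<inter> {v. 0 \<le> (\<Sum>j\<in>-J. v $ j * a $ j)}"
  have "{v::real^3. 0 \<le> (\<Sum>j\<in>-J. v $ j * a $ j)} \<in> sets borel" by measurable
  then have S: "?S \<in> sets borel" by auto
  have "{v::real^3. (\<forall>j\<in>J. 0 \<le> v $ j * a $ j)} \<in> sets borel" by measurable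
  moreover have W: "W = ?S \<inter> {v. \<forall>j\<in>J. 0 \<le> v $ j * a $ j}"
    by (auto simp: W_def)
  ultimately have "W \<in> sets borel" using S by auto
  moreover have "W \<subseteq> ?B" by (auto simp: W_def)
  ultimately show "W \<in> lmeasurable"
    using bounded_subset[OF bounded_cball] by (intro bounded_set_imp_lmeasurable) auto
  have "4 / 3 * pi * r ^ 3 = measure lebesgue ?B"
    using content_cball[OF assms(1), of "0::real^3"] by (simp add: unit_ball_vol_3 measure_completion)
  also have "\<dots> \<le> 2 * measure lebesgue ?S"
    using S by (intro halfspace_measure_ge_half[where A = "-J"])
      (auto intro!: bounded_set_imp_lmeasurable simp: sum_negf)
  also have "measure lebesgue ?S \<le> 2 ^ card J * measure lebesgue W"
    unfolding W
  proof (rule orthant_measure_ge)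
    show "bounded ?S" by auto
    fix j v assume "j \<in> J" "v \<in> ?S"
    moreover from this have "(\<Sum>i\<in>-J. flip {j} v $ i * a $ i) = (\<Sum>i\<in>-J. v $ i * a $ i)"
      by (intro sum.cong) auto
    ultimately show "flip {j} v \<in> ?S" by auto
  qed (rule S)
  finally show "4 / 3 * pi * r ^ 3 \<le> 2 * 2 ^ card J * measure lebesgue W" by simp
qed

section \<open>Greedy routing towards the centre\<close>

definition cell_of :: "real^3 \<Rightarrow> 3 \<Rightarrow> int" where
  "cell_of x = (\<lambda>i. \<lfloor>x $ i\<rfloor>)"

definition empty_cells :: "nat \<Rightarrow> (nat \<Rightarrow> real^3) \<Rightarrow> int \<Rightarrow> (3 \<Rightarrow> int) set" where
  "empty_cells n P N = {q. (\<forall>i. 0 \<le> q i \<and> q i < N) \<and> (\<forall>k<n. cell_of (P k) \<noteq> q)}"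

definition cell_nbhd :: "int \<Rightarrow> (3 \<Rightarrow> int) \<Rightarrow> (3 \<Rightarrow> int) set" where
  "cell_nbhd h g = {q. \<forall>i. \<bar>q i - g i\<bar> \<le> h}"

text \<open>Only \<open>O(N ^ (3 - k))\<close> cells have \<open>k\<close> special coordinates. Cells near the faces, edges
  and corners need a smaller quota because fewer positions are available there to a node's
  next hop; \<open>N / 2\<close> is included so that all cells near the centre are occupied as well.\<close>

definition special :: "int \<Rightarrow> int \<Rightarrow> (3 \<Rightarrow> int) \<Rightarrow> 3 set" where
  "special h N g = {i. g i \<le> h \<or> N - h \<le> g i \<or> \<bar>2 * g i - N\<bar> \<le> 2 * h}"

text \<open>With \<open>N ^ 3 \<le> 3 * m * n / ln n\<close>, a given set of \<open>(3 - k) * m\<close> cells is empty with probability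
  at most \<open>n powr (- (3 - k) / 3)\<close>, which just beats the number of cells with \<open>k\<close> special
  coordinates.\<close>

definition quota :: "nat \<Rightarrow> nat \<Rightarrow> nat" where
  "quota m k = (if k = 3 then 1 else (3 - k) * m)"

text \<open>The diagonal of a unit cell is \<open>sqrt 3\<close>; the rounder bound 2 is the slack
  that reappears in \<open>R - 2\<close>.\<close>

lemma dist_same_cell:
  assumes "cell_of x = cell_of y"
  shows "dist x y < 2"
proof -
  have "(x $ i - y $ i)\<^sup>2 \<le> 1" for i
  proof -
    have "\<lfloor>x $ i\<rfloor> = \<lfloor>y $ i\<rfloor>"
      using assms by (simp add: cell_of_def fun_eq_iff)
    then have "\<bar>x $ i - y $ i\<bar> \<le> 1" by linarith
    then show ?thesis using abs_square_le_1 by blast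
  qed
  then have "(\<Sum>i\<in>UNIV. (x $ i - y $ i)\<^sup>2) \<le> (\<Sum>i\<in>(UNIV::3 set). 1)"
    by (intro sum_mono)
  then have "(\<Sum>i\<in>UNIV. (x $ i - y $ i)\<^sup>2) < 2\<^sup>2" by simp
  then have "sqrt (\<Sum>i\<in>UNIV. (x $ i - y $ i)\<^sup>2) < sqrt (2\<^sup>2)" by (rule real_sqrt_less_mono)
  then show ?thesis by (simp add: dist_norm norm_vec_def L2_set_def)
qed

lemma cell_nbhd_eq_PiE: "cell_nbhd h g = Pi\<^sub>E UNIV (\<lambda>i. {g i - h..g i + h})"
  by (simp add: cell_nbhd_def PiE_UNIV_domain Pi_def abs_le_iff algebra_simps conj_commute)

lemma finite_cell_nbhd [simp]: "finite (cell_nbhd h g)"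
  by (simp add: cell_nbhd_eq_PiE finite_PiE)

lemma cell_nbhdI: 
  assumes "dist x y \<le> r" "r + 1 \<le> h"
  shows "cell_of y \<in> cell_nbhd h (cell_of x)"
proof -
  have "\<bar>\<lfloor>y $ i\<rfloor> - \<lfloor>x $ i\<rfloor>\<bar> \<le> h" for i
  proof -
    have "\<bar>x $ i - y $ i\<bar> \<le> r"
      using assms(1) dist_vec_nth_le[of x i y] by (simp add: dist_real_def)
    with assms(2) show ?thesis by linarith
  qed
  then show ?thesis by (simp add: cell_nbhd_def cell_of_def)
qed

text \<open>The deterministic setting, with the cell side as unit of length. In \<open>voids\<close>
  the value \<open>g i = N\<close> is allowed because a node may lie on the far face. The first
  bound on \<open>h\<close> lets one neighbourhood contain all aims of \<open>12 * m\<close>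
  consecutive hops; the second makes all three coordinates special at nodes closer than
  \<open>R * R\<close> to the centre. In \<open>vol\<close>, \<open>48 / 5\<close> is
  \<open>3 * (16 / 5)\<close>, where \<open>16 / 5\<close> bounds \<open>1 + l\<close> from
  below.\<close>

locale sparse_voids =
  fixes n m :: nat and h N :: int and P :: "nat \<Rightarrow> real^3" and R :: real
  assumes in_cube: "\<And>k i. k < n \<Longrightarrow> 0 \<le> P k $ i \<and> P k $ i \<le> N"
    and voids: "\<And>g. (\<And>i. 0 \<le> g i \<and> g i \<le> N) \<Longrightarrow>
      card (empty_cells n P N \<inter> cell_nbhd h g) < quota m (card (special h N g))"
    and R_large: "1000 \<le> R"
    and m_pos: "0 < m"
    and vol: "48 / 5 * m \<le> 4 / 3 * pi * R ^ 3"
    and h_large: "(12 * real m + 2) * R + 2 \<le> h" "R\<^sup>2 + 2 \<le> h"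
    and N_large: "4 * R \<le> N"
begin

definition centre :: "real^3" where "centre = (\<chi> i. N / 2)"

lemma centre_nth [simp]: "centre $ i = N / 2"
  by (simp add: centre_def)

lemma R_le_h: "R + 2 \<le> h"
proof -
  have "1 * R \<le> (12 * real m + 2) * R" using R_large by (intro mult_right_mono) auto
  with h_large show ?thesis by linarith
qed

lemma cell_of_node_range: "k < n \<Longrightarrow> 0 \<le> cell_of (P k) i \<and> cell_of (P k) i \<le> N"
  using in_cube[of k i] by (simp add: cell_of_def) linarith

lemma occupied:
  assumes "\<And>i. 0 \<le> w $ i \<and> w $ i < N" "cell_of w \<notin> empty_cells n P N"
  obtains k where "k < n" "dist (P k) w < 2"
proof -
  have "0 \<le> cell_of w i \<and> cell_of w i < N" for i
    using assms(1)[of i] by (simp add: cell_of_def floor_less_iff)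
  with assms(2) obtain k where "k < n" "cell_of (P k) = cell_of w"
    by (auto simp: empty_cells_def)
  then show ?thesis using that dist_same_cell by blast
qed

text \<open>The points of the cube that are within range and lead towards the centre fill a volume
  of at least the quota, while the empty cells nearby cover less, so some such point lies in an
  occupied cell. Cells with three special coordinates are left to \<open>step\<close>, where quota 1
  forbids voids.\<close>

lemma weak_step:
  assumes k: "k < n" and far: "R\<^sup>2 \<le> dist (P k) centre"
    and sp: "card (special h N (cell_of (P k))) \<le> 2"
  shows "\<exists>j<n. dist (P k) (P j) \<le> R \<and> dist (P j) centre \<le> dist (P k) centre - 1"
proof -
  define x where "x = P k"
  define a where "a = centre - x"
  define e where "e = (1 / norm a) *\<^sub>R a"
  \<comment> \<open>Points up to distance \<open>R - 2\<close> are targets; the node found in the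
    cell of the target is then still within range.\<close>
  define \<rho> where "\<rho> = R - 2"
  define J where "J = {i. x $ i < R \<or> N - R < x $ i}"
  define W0 where "W0 = {v. norm v \<le> 19 / 20 * \<rho> \<and> (\<forall>j\<in>J. 0 \<le> v $ j * a $ j) \<and>
      0 \<le> (\<Sum>j\<in>-J. v $ j * a $ j)}"
  \<comment> \<open>Shifting the wedge by \<open>\<rho> / 20\<close> towards the centre makes the progress strictly positive.
    The reflections give it the fraction \<open>2 ^ (- card J - 1)\<close> of a ball; this is where
    \<open>l > 11 / 5\<close> enters, in the form \<open>vol\<close>.\<close>
  define W where "W = (+) (x + (\<rho> / 20) *\<^sub>R e) ` W0"
  let ?K = "card (special h N (cell_of x))"
  have x_range: "0 \<le> x $ i" "x $ i \<le> N" for i using in_cube[OF k] by (auto simp: x_def)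
  have \<rho>: "998 \<le> \<rho>" "\<rho> < R" using R_large by (auto simp: \<rho>_def)
  have na: "R\<^sup>2 \<le> norm a" using far by (simp add: a_def x_def dist_norm norm_minus_commute)
  have "0 < R\<^sup>2" using R_large by simp
  with na have na0: "0 < norm a" by linarith
  have ne: "norm e = 1" using na0 by (simp add: e_def)
  have J_special: "J \<subseteq> special h N (cell_of x)"
    using R_le_h by (auto simp: J_def special_def cell_of_def) linarith+
  then have card_J: "card J \<le> ?K" by (intro card_mono) auto
  have W0: "W0 \<in> lmeasurable" "4 / 3 * pi * (19 / 20 * \<rho>) ^ 3 \<le> 2 * 2 ^ card J * measure lebesgue W0"
    using ball_wedge_measure_ge[of "19 / 20 * \<rho>" J a] \<rho> unfolding W0_def by auto
  \<comment> \<open>Since \<open>R >= 1000\<close>, the radius is at least \<open>0.948 * R\<close>,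
    and \<open>0.948 ^ 3 >= 5 / 6\<close> turns \<open>48 / 5\<close> into 8.\<close>
  have "8 * real m \<le> 4 / 3 * pi * (19 / 20 * \<rho>) ^ 3"
  proof -
    have "(474 / 500 * R) ^ 3 \<le> (19 / 20 * \<rho>) ^ 3"
      using R_large by (intro power_mono) (auto simp: \<rho>_def)
    moreover have "5 / 6 * R ^ 3 \<le> (474 / 500 * R) ^ 3"
      using R_large by (simp add: power_mult_distrib power_divide)
    ultimately have "5 / 6 * R ^ 3 \<le> (19 / 20 * \<rho>) ^ 3" by linarith
    then have "4 / 3 * pi * (5 / 6 * R ^ 3) \<le> 4 / 3 * pi * (19 / 20 * \<rho>) ^ 3"
      by (intro mult_left_mono) auto
    with vol show ?thesis by linarith
  qed
  also note W0(2)
  also have "2 * 2 ^ card J * measure lebesgue W0 \<le> 2 * 2 ^ ?K * measure lebesgue W0"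
    using card_J by (intro mult_right_mono mult_left_mono power_increasing) auto
  finally have big: "8 * real m \<le> 2 * 2 ^ ?K * measure lebesgue W0" .
  have "?K \<le> 2" using sp by (simp add: x_def)
  then consider "?K = 0" | "?K = 1" | "?K = 2" by linarith
  \<comment> \<open>For \<open>?K = 0, 1, 2\<close> the volume is at least \<open>4 * m\<close>,
    \<open>2 * m\<close>, \<open>m\<close>, against the quotas \<open>3 * m\<close>,
    \<open>2 * m\<close>, \<open>m\<close>.\<close>
  then have quota_le: "quota m ?K \<le> measure lebesgue W0"
    by cases (use big m_pos in \<open>auto simp: quota_def\<close>)
  have W: "W \<in> lmeasurable" "measure lebesgue W = measure lebesgue W0"
    using W0(1) by (auto simp: W_def measurable_translation measure_translation)
  have W_props: "dist x w \<le> \<rho> \<and> dist w centre \<le> dist x centre - 3 \<and> (\<forall>i. 0 \<le> w $ i \<and> w $ i < N)"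
    if w: "w \<in> W" for w
  proof -
    from w obtain v where v: "v \<in> W0" "w = x + (\<rho> / 20) *\<^sub>R e + v" by (auto simp: W_def)
    define u where "u = (\<rho> / 20) *\<^sub>R e + v"
    have wu: "w = x + u" by (simp add: v u_def)
    have nu: "norm u \<le> \<rho>"
      using norm_triangle_ineq[of "(\<rho> / 20) *\<^sub>R e" v] v(1) \<rho> ne
      by (simp add: u_def W0_def)
    have "0 \<le> (\<Sum>j\<in>J. v $ j * a $ j)" using v(1) by (intro sum_nonneg) (auto simp: W0_def)
    moreover have "0 \<le> (\<Sum>j\<in>-J. v $ j * a $ j)" using v(1) by (simp add: W0_def)
    moreover have "v \<bullet> a = (\<Sum>j\<in>J. v $ j * a $ j) + (\<Sum>j\<in>-J. v $ j * a $ j)"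
      unfolding inner_vec_def using sum.union_disjoint[of J "-J" "\<lambda>j. v $ j * a $ j"] by (simp add: Compl_partition)
    ultimately have "0 \<le> v \<bullet> a" by simp
    moreover have "e \<bullet> a = norm a" using na0 by (simp add: e_def dot_square_norm power2_eq_square)
    ultimately have ua: "\<rho> / 20 * norm a \<le> u \<bullet> a" by (simp add: u_def inner_add_left)
    have "(dist w centre)\<^sup>2 = (norm (u - a))\<^sup>2"
      by (simp add: wu a_def dist_norm algebra_simps)
    also have "\<dots> = (norm u)\<^sup>2 - 2 * (u \<bullet> a) + (norm a)\<^sup>2"
      by (simp add: power2_norm_eq_inner inner_diff_left inner_diff_right inner_commute)
    \<comment> \<open>By the shift along \<open>e\<close>, twice the inner product of
      \<open>u\<close> and \<open>a\<close> is at least \<open>7 * norm a\<close>. One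
      \<open>norm a\<close> absorbs the square of \<open>R\<close>, by \<open>far\<close>; the other
      six yield the gain 3, of which 2 are later lost in passing from \<open>w\<close> to a
      node.\<close>
    also have "\<dots> \<le> (norm a - 3)\<^sup>2"
    proof -
      have "(norm u)\<^sup>2 \<le> R\<^sup>2" using nu \<rho> by (intro power_mono) auto
      moreover have "7 * norm a \<le> 2 * (\<rho> / 20 * norm a)" using \<rho> na0 by simp
      moreover have "(norm a - 3)\<^sup>2 = (norm a)\<^sup>2 - 6 * norm a + 9" by (simp add: power2_diff)
      ultimately show ?thesis using ua na by linarith
    qed
    finally have "\<bar>dist w centre\<bar> \<le> \<bar>norm a - 3\<bar>" by (subst abs_le_square_iff)
    moreover have "1000\<^sup>2 \<le> R\<^sup>2" using R_large by (intro power_mono) auto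
    ultimately have dw: "dist w centre \<le> norm a - 3" using na by simp
    \<comment> \<open>Away from the faces a move of length less than \<open>R\<close> stays in the
      cube. Near a face neither \<open>v\<close> nor \<open>e\<close> points outwards in that
      coordinate, and the opposite face is out of reach since \<open>4 * R <= N\<close>.\<close>
    have range: "0 \<le> w $ i \<and> w $ i < N" for i
    proof (cases "i \<in> J")
      case False
      then show ?thesis using component_le_norm_cart[of u i] nu \<rho> by (auto simp: J_def wu)
    next
      case True
      have ui: "\<bar>u $ i\<bar> \<le> \<rho>" using component_le_norm_cart[of u i] nu by simp
      have va: "0 \<le> v $ i * a $ i" using v(1) True by (simp add: W0_def)
      have ea: "e $ i = a $ i / norm a" by (simp add: e_def)
      consider "x $ i < R" | "N - R < x $ i" using True by (auto simp: J_def)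
      then show ?thesis
      proof cases
        case 1
        then have ai: "0 < a $ i" using N_large R_large by (simp add: a_def)
        then have "0 \<le> v $ i" "0 \<le> e $ i" using va ea by (auto simp: zero_le_mult_iff)
        then have "0 \<le> u $ i" using \<rho> by (simp add: u_def)
        then show ?thesis using ui 1 x_range[of i] \<rho> N_large by (simp add: wu)
      next
        case 2
        then have ai: "a $ i < 0" using N_large R_large by (simp add: a_def)
        then have "v $ i \<le> 0" "e $ i < 0" using va ea na0 by (auto simp: zero_le_mult_iff divide_less_0_iff)
        then have "u $ i < 0" using \<rho> by (simp add: u_def add_neg_nonpos mult_pos_neg)
        then show ?thesis using ui 2 x_range[of i] \<rho> N_large by (simp add: wu)
      qed
    qed
    show ?thesis using nu dw range by (simp add: wu a_def dist_norm norm_minus_commute)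
  qed
  have "\<exists>w\<in>W. cell_of w \<notin> empty_cells n P N"
  proof (rule ccontr)
    assume all_empty: "\<not> ?thesis"
    let ?E = "empty_cells n P N \<inter> cell_nbhd h (cell_of x)"
    define Q :: "(3 \<Rightarrow> int) \<Rightarrow> (real^3) set" where "Q q = cbox (\<chi> i. q i) (\<chi> i. q i + 1)" for q
    have Q: "Q q \<in> lmeasurable" "measure lebesgue (Q q) = 1" for q
    proof -
      have "Q q \<noteq> {}" unfolding Q_def interval_ne_empty_cart by simp
      then show "measure lebesgue (Q q) = 1" unfolding Q_def by (simp add: content_cbox_cart measure_completion)
    qed (simp add: Q_def)
    have "W \<subseteq> (\<Union>q\<in>?E. Q q)"
    proof
      fix w assume w: "w \<in> W"
      have "cell_of w \<in> cell_nbhd h (cell_of x)"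
        using W_props[OF w] R_le_h \<rho> by (intro cell_nbhdI[where r = \<rho>]) (auto simp: \<rho>_def)
      moreover have "w \<in> Q (cell_of w)" 
        by (auto simp: Q_def mem_box_cart cell_of_def intro: less_imp_le)
      ultimately show "w \<in> (\<Union>q\<in>?E. Q q)" using all_empty w by blast
    qed
    then have "measure lebesgue W \<le> measure lebesgue (\<Union>q\<in>?E. Q q)"
      using W Q by (intro measure_mono_fmeasurable fmeasurable.finite_UN) auto
    also have "\<dots> \<le> (\<Sum>q\<in>?E. measure lebesgue (Q q))"
      using Q by (intro measure_UNION_le) auto
    also have "\<dots> = card ?E" by (simp add: Q)
    also have "card ?E < quota m ?K"
      using voids cell_of_node_range[OF k] by (auto simp: x_def)
    finally show False using quota_le W by simp
  qed
  then obtain w where w: "w \<in> W" "cell_of w \<notin> empty_cells n P N" by blast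
  obtain j where j: "j < n" "dist (P j) w < 2"
    by (rule occupied[OF _ w(2)]) (use W_props[OF w(1)] in auto)
  have "dist x (P j) \<le> R" "dist (P j) centre \<le> dist x centre - 1"
    using W_props[OF w(1)] j(2) dist_triangle[of x "P j" w] dist_triangle[of "P j" centre w]
    by (auto simp: \<rho>_def dist_commute)
  then show ?thesis using j by (auto simp: x_def)
qed

end

lemma sym_relpow: "sym r \<Longrightarrow> sym (r ^^ t)"
proof (induction t)
  case (Suc t)
  show ?case
  proof (rule symI)
    fix a b assume "(a, b) \<in> r ^^ Suc t"
    then obtain c where "(a, c) \<in> r ^^ t" "(c, b) \<in> r" by auto
    with Suc have "(b, c) \<in> r" "(c, a) \<in> r ^^ t" by (meson symD)+
    then show "(b, a) \<in> r ^^ Suc t" by (rule relpow_Suc_I2)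
  qed
qed (simp add: sym_Id)

section \<open>From single hops to walks through the centre\<close>

context sparse_voids begin

abbreviation \<Phi> :: "nat \<Rightarrow> real" where
  "\<Phi> k \<equiv> dist (P k) centre"

text \<open>A point of the segment to the centre when the node is farther than \<open>R - 2\<close>
  from it. The 2 short of the range pays for the way from the aim to a node of its cell, so such a
  hop gains \<open>R - 4\<close>.\<close>

definition aim :: "nat \<Rightarrow> real^3" where
  "aim k = P k + ((R - 2) / \<Phi> k) *\<^sub>R (centre - P k)"

lemma aim_props:
  assumes "k < n" "R - 2 < \<Phi> k"
  shows "dist (aim k) centre = \<Phi> k - (R - 2)" "dist (P k) (aim k) = R - 2"
    "0 \<le> aim k $ i" "aim k $ i < N"
proof -
  define t where "t = (R - 2) / \<Phi> k"
  have pos: "0 < \<Phi> k" using assms R_large by linarith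
  have t: "0 < t" "t < 1" using assms R_large pos by (auto simp: t_def)
  have t\<Phi>: "t * \<Phi> k = R - 2" using pos by (simp add: t_def)
  have "aim k - centre = (1 - t) *\<^sub>R (P k - centre)"
    by (simp add: aim_def t_def[symmetric] algebra_simps)
  then show "dist (aim k) centre = \<Phi> k - (R - 2)"
    using t t\<Phi> by (simp add: dist_norm left_diff_distrib)
  have "P k - aim k = t *\<^sub>R (P k - centre)"
    by (simp add: aim_def t_def[symmetric] algebra_simps)
  then show "dist (P k) (aim k) = R - 2"
    using t t\<Phi> by (simp add: dist_norm)
  have aim: "aim k $ i = (1 - t) * P k $ i + t * (N / 2)"
    by (simp add: aim_def t_def[symmetric] algebra_simps)
  have N: "0 < real_of_int N" using N_large R_large by linarith
  show "0 \<le> aim k $ i" using aim t N in_cube[OF assms(1), of i] by simp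
  have "(1 - t) * P k $ i \<le> (1 - t) * N" using t in_cube[OF assms(1), of i] by (intro mult_left_mono) auto
  moreover have "t * (N / 2) < t * N" using t N by (intro mult_strict_left_mono) auto
  ultimately show "aim k $ i < N" using aim by (simp add: algebra_simps)
qed

lemma special_full:
  assumes "\<And>i. 0 \<le> g i \<and> g i \<le> N" "card (special h N g) = 3" "q \<in> cell_nbhd h g"
  shows "q \<notin> empty_cells n P N"
proof -
  have "card (empty_cells n P N \<inter> cell_nbhd h g) < 1"
    using voids[of g] assms(1,2) by (simp add: quota_def)
  then show ?thesis using assms(3) by (auto simp: card_eq_0_iff)
qed

text \<open>An occupied aim cell gives the long hop at once. An empty one excludes three special
  coordinates, since quota 1 allows no void nearby; hence the node is far from the centre and
  \<open>weak_step\<close> applies.\<close>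

lemma step:
  assumes k: "k < n" and far: "R - 2 < \<Phi> k"
  shows "\<exists>j<n. dist (P k) (P j) \<le> R \<and> \<Phi> j \<le> \<Phi> k - 1 \<and>
    (\<Phi> j \<le> \<Phi> k - (R - 4) \<or> cell_of (aim k) \<in> empty_cells n P N)"
proof (cases "cell_of (aim k) \<in> empty_cells n P N")
  case False
  obtain j where j: "j < n" "dist (P j) (aim k) < 2"
    by (rule occupied[OF _ False]) (use aim_props[OF assms] in auto)
  have "dist (P k) (P j) \<le> R" "\<Phi> j \<le> \<Phi> k - (R - 4)"
    using aim_props[OF assms] j(2) dist_triangle[of "P k" "P j" "aim k"]
      dist_triangle[of "P j" centre "aim k"] by (auto simp: dist_commute)
  then show ?thesis using j R_large by (intro exI[of _ j]) auto
next
  case True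
  let ?g = "cell_of (P k)"
  have "cell_of (aim k) \<in> cell_nbhd h ?g"
    using aim_props[OF assms] R_le_h by (intro cell_nbhdI[where r = "R - 2"]) auto
  with True have not3: "card (special h N ?g) \<noteq> 3"
    using special_full cell_of_node_range[OF k] by blast
  have "card (special h N ?g) \<le> card (UNIV :: 3 set)" by (intro card_mono) auto
  with not3 have le2: "card (special h N ?g) \<le> 2" by simp
  have "R\<^sup>2 \<le> \<Phi> k"
  proof (rule ccontr)
    assume near: "\<not> ?thesis"
    have "i \<in> special h N ?g" for i
    proof -
      have "\<bar>P k $ i - N / 2\<bar> \<le> \<Phi> k"
        using dist_vec_nth_le[of "P k" i centre] by (simp add: dist_real_def)
      then have "\<bar>2 * P k $ i - N\<bar> \<le> 2 * h - 2" using near h_large by linarith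
      then have "\<bar>2 * \<lfloor>P k $ i\<rfloor> - N\<bar> \<le> 2 * h" by linarith
      then show ?thesis by (simp add: special_def cell_of_def)
    qed
    then have "special h N ?g = UNIV" by auto
    then show False using not3 by simp
  qed
  then show ?thesis using weak_step[OF k _ le2] True by auto
qed

definition edges :: "(nat \<times> nat) set" where
  "edges = {(i, j). i < n \<and> j < n \<and> i \<noteq> j \<and> dist (P i) (P j) \<le> R}"

text \<open>Failing hops aim at empty cells of one fixed neighbourhood of the start. There are at
  most \<open>3 * m\<close> of these, each hit at most twice, so at least \<open>6 * m\<close> of
  the \<open>12 * m\<close> hops gain \<open>R - 4\<close>.\<close>

lemma window:
  assumes k: "k < n"
  shows "\<exists>j<n. \<exists>t \<le> 12 * m. (k, j) \<in> edges ^^ t \<and> (\<Phi> j \<le> R - 2 \<or> \<Phi> j \<le> \<Phi> k - 6 * m * (R - 4))"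
proof (rule ccontr)
  assume contra: "\<not> ?thesis"
  obtain f where f: "\<And>k. k < n \<Longrightarrow> R - 2 < \<Phi> k \<Longrightarrow> f k < n \<and> dist (P k) (P (f k)) \<le> R \<and> \<Phi> (f k) \<le> \<Phi> k - 1 \<and>
    (\<Phi> (f k) \<le> \<Phi> k - (R - 4) \<or> cell_of (aim k) \<in> empty_cells n P N)"
    using step by metis
  define x where "x t = (f ^^ t) k" for t
  have x_Suc: "x (Suc t) = f (x t)" and x_0: "x 0 = k" for t by (auto simp: x_def)
  \<comment> \<open>Negating the claim keeps the greedy orbit outside the core of radius
    \<open>R - 2\<close>, so \<open>step\<close> applies at every hop. The decrease of the distance
    also shows that successive nodes differ, as \<open>edges\<close> demands.\<close>
  have x: "x t < n \<and> (k, x t) \<in> edges ^^ t \<and> R - 2 < \<Phi> (x t) \<and> dist (P k) (P (x t)) \<le> t * R"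
    if "t \<le> 12 * m" for t
    using that
  proof (induction t)
    case 0
    then show ?case using contra k by (fastforce simp: x_0)
  next
    case (Suc t)
    then have IH: "x t < n" "(k, x t) \<in> edges ^^ t" "R - 2 < \<Phi> (x t)" "dist (P k) (P (x t)) \<le> t * R"
      by auto
    note f = f[OF IH(1,3), folded x_Suc]
    then have "x t \<noteq> x (Suc t)" by auto
    then have "(x t, x (Suc t)) \<in> edges" using f IH by (auto simp: edges_def)
    then have e: "(k, x (Suc t)) \<in> edges ^^ Suc t" using IH by auto
    moreover have "dist (P k) (P (x (Suc t))) \<le> Suc t * R"
      using dist_triangle[of "P k" "P (x (Suc t))" "P (x t)"] f IH by (simp add: algebra_simps)
    ultimately show ?case using f contra Suc.prems by (meson not_le)
  qed
  define F where "F = {t. t < 12 * m \<and> cell_of (aim (x t)) \<in> empty_cells n P N}"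
  have step_x: "\<Phi> (x (Suc t)) \<le> \<Phi> (x t) - 1 \<and> (\<Phi> (x (Suc t)) \<le> \<Phi> (x t) - (R - 4) \<or> t \<in> F)"
    if "t < 12 * m" for t
    using f[of "x t"] x[of t] that by (auto simp: x_Suc F_def)
  have decrease: "\<Phi> (x (t + d)) \<le> \<Phi> (x t) - d" if "t + d \<le> 12 * m" for t d
    using that
  proof (induction d)
    case (Suc d)
    then show ?case using step_x[of "t + d"] by simp
  qed simp
  \<comment> \<open>Only successful hops are credited; of the failing ones it matters only that they
    lose no ground.\<close>
  have progress: "\<Phi> (x t) \<le> \<Phi> k - card ({..<t} - F) * (R - 4)" if "t \<le> 12 * m" for t
    using that
  proof (induction t)
    case (Suc t)
    have IH: "\<Phi> (x t) \<le> \<Phi> k - card ({..<t} - F) * (R - 4)" using Suc by simp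
    show ?case
    proof (cases "t \<in> F")
      case True
      then have "{..<Suc t} - F = {..<t} - F" by (auto simp: less_Suc_eq)
      then show ?thesis using IH step_x[of t] Suc.prems by simp
    next
      case False
      then have "{..<Suc t} - F = insert t ({..<t} - F)" by (auto simp: less_Suc_eq)
      then have "card ({..<Suc t} - F) = Suc (card ({..<t} - F))" by simp
      then show ?thesis using IH step_x[of t] Suc.prems False by (simp add: distrib_right)
    qed
  qed (simp add: x_0)
  let ?E = "empty_cells n P N \<inter> cell_nbhd h (cell_of (P k))"
  \<comment> \<open>Targets two or more hops apart are at distance at least 2, hence in different cells,
    so a cell and the parity of \<open>t\<close> determine the failing hop \<open>t\<close>.\<close>
  have "inj_on (\<lambda>t. (cell_of (aim (x t)), even t)) F"
  proof (rule linorder_inj_onI')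
    fix s t assume st: "s \<in> F" "t \<in> F" "s < t"
    show "(cell_of (aim (x s)), even s) \<noteq> (cell_of (aim (x t)), even t)"
    proof
      assume eq: "(cell_of (aim (x s)), even s) = (cell_of (aim (x t)), even t)"
      have le: "s \<le> 12 * m" "t \<le> 12 * m" using st by (auto simp: F_def)
      have "t \<noteq> Suc s" using eq by auto
      then have "s + 2 \<le> t" using st(3) by linarith
      then have "\<Phi> (x t) \<le> \<Phi> (x s) - 2" using decrease[of s "t - s"] le by simp
      moreover have "dist (aim (x s)) (aim (x t)) < 2" using eq by (intro dist_same_cell) auto
      ultimately show False
        using dist_triangle[of "aim (x s)" centre "aim (x t)"] aim_props(1)[of "x s"] aim_props(1)[of "x t"]
          x[of s] x[of t] le by auto
    qed
  qed
  moreover have "(\<lambda>t. (cell_of (aim (x t)), even t)) ` F \<subseteq> ?E \<times> UNIV"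
  proof -
    have "cell_of (aim (x t)) \<in> cell_nbhd h (cell_of (P k))" if "t \<in> F" for t
    proof (rule cell_nbhdI)
      have t: "t \<le> 12 * m" using that by (auto simp: F_def)
      have "t * R \<le> 12 * m * R" using t R_large by (intro mult_right_mono) auto
      then show "dist (P k) (aim (x t)) \<le> 12 * m * R + R"
        using aim_props(2)[of "x t"] x[OF t] dist_triangle[of "P k" "aim (x t)" "P (x t)"] by linarith
      show "12 * m * R + R + 1 \<le> h" using h_large(1) R_large by (simp add: algebra_simps)
    qed
    then show ?thesis by (auto simp: F_def)
  qed
  ultimately have "card F \<le> card (?E \<times> (UNIV :: bool set))"
    by (intro card_inj_on_le) auto
  also have "\<dots> = 2 * card ?E" by (simp add: card_cartesian_product)
  also have "card ?E \<le> quota m (card (special h N (cell_of (P k))))"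
    using voids cell_of_node_range[OF k] less_imp_le by blast
  also have "\<dots> \<le> 3 * m" using m_pos by (simp add: quota_def)
  finally have "card F \<le> 6 * m" by simp
  moreover have "card {..<12 * m} - card F \<le> card ({..<12 * m} - F)"
    by (intro diff_card_le_card_Diff) (auto simp: F_def)
  ultimately have "6 * m \<le> card ({..<12 * m} - F)" by simp
  then have "6 * real m * (R - 4) \<le> card ({..<12 * m} - F) * (R - 4)"
    using R_large by (intro mult_right_mono) auto
  then have "\<Phi> (x (12 * m)) \<le> \<Phi> k - 6 * m * (R - 4)" using progress[of "12 * m"] by simp
  then show False using contra x[of "12 * m"] by blast
qed

lemma reach_core:
  assumes "k < n" "\<Phi> k \<le> R - 2 + q * (6 * m * (R - 4))"
  shows "\<exists>j<n. \<exists>t \<le> q * (12 * m). (k, j) \<in> edges ^^ t \<and> \<Phi> j \<le> R - 2"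
  using assms
proof (induction q arbitrary: k)
  case 0
  then show ?case by (intro exI[of _ k]) auto
next
  case (Suc q)
  obtain i s where i: "i < n" "s \<le> 12 * m" "(k, i) \<in> edges ^^ s"
      "\<Phi> i \<le> R - 2 \<or> \<Phi> i \<le> \<Phi> k - 6 * m * (R - 4)"
    using window[OF Suc.prems(1)] by blast
  \<comment> \<open>A window may end early inside the core; nonnegativity keeps the induction
    hypothesis applicable there.\<close>
  have "0 \<le> q * (6 * m * (R - 4))" using R_large by simp
  then have "\<Phi> i \<le> R - 2 + q * (6 * m * (R - 4))"
    using i(4) Suc.prems(2) by (auto simp: algebra_simps)
  from Suc.IH[OF i(1) this] obtain j t where
    j: "j < n" "t \<le> q * (12 * m)" "(i, j) \<in> edges ^^ t" "\<Phi> j \<le> R - 2" by blast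
  have "(k, j) \<in> edges ^^ (s + t)" using i(3) j(3) by (auto simp: relpow_add)
  moreover have "s + t \<le> Suc q * (12 * m)" using i(2) j(2) by simp
  ultimately show ?case using j by blast
qed

text \<open>All coordinates of the cell of the centre are special, because \<open>N div 2\<close> is
  within 1 of \<open>N / 2\<close>, so this cell is occupied.\<close>

lemma centre_node: "\<exists>z<n. dist (P z) centre < 2"
proof -
  have N: "0 < N" using N_large R_large by auto
  have h: "2 \<le> h" using R_le_h R_large by linarith
  have sp: "special h N (cell_of centre) = UNIV"
    using h by (auto simp: special_def cell_of_def) linarith+
  have "cell_of centre \<notin> empty_cells n P N"
  proof (rule special_full)
    show "0 \<le> cell_of centre i \<and> cell_of centre i \<le> N" for i
      using N by (simp add: cell_of_def floor_le_iff)
    show "card (special h N (cell_of centre)) = 3" by (simp add: sp)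
    show "cell_of centre \<in> cell_nbhd h (cell_of centre)" using h by (simp add: cell_nbhd_def)
  qed
  then show ?thesis
    using occupied[of centre] N by auto
qed

text \<open>No point of the cube is farther from the centre than half the diagonal,
  \<open>sqrt 3 / 2 * N\<close>.\<close>

lemma \<Phi>_le_N:
  assumes "k < n" shows "\<Phi> k \<le> N"
proof -
  have N: "0 < real_of_int N" using N_large R_large by linarith
  have "(P k $ i - N / 2)\<^sup>2 \<le> (N / 2)\<^sup>2" for i
    using in_cube[OF assms, of i] by (intro abs_le_square_iff[THEN iffD1]) (simp add: abs_if)
  then have "(\<Sum>i\<in>UNIV. (P k $ i - N / 2)\<^sup>2) \<le> (\<Sum>i\<in>(UNIV :: 3 set). (N / 2)\<^sup>2)"
    by (intro sum_mono)
  also have "\<dots> \<le> N\<^sup>2" by (simp add: power_divide)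
  finally have "sqrt (\<Sum>i\<in>UNIV. (P k $ i - N / 2)\<^sup>2) \<le> sqrt (N\<^sup>2)" by (rule real_sqrt_le_mono)
  then show ?thesis using N by (simp add: dist_norm norm_vec_def L2_set_def)
qed

text \<open>Both nodes walk to one node \<open>z\<close> near the centre, in about
  \<open>2 * N / R\<close> hops each, and the second walk is reversed. The term
  \<open>24 * m\<close> pays for rounding up the number \<open>q\<close> of windows, and 2 for the
  last hops into \<open>z\<close>.\<close>

lemma short_walk:
  assumes "i < n" "j < n"
  shows "\<exists>t. (i, j) \<in> edges ^^ t \<and> t \<le> 5 * N / R + 24 * m + 2"
proof -
  obtain z where z: "z < n" "dist (P z) centre < 2" using centre_node by blast
  define q where "q = nat \<lceil>N / (6 * m * (R - 4))\<rceil>"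
  have N: "0 < real_of_int N" using N_large R_large by linarith
  have D: "0 < 6 * real m * (R - 4)" using m_pos R_large by simp
  have q: "N / (6 * m * (R - 4)) \<le> q" "q \<le> N / (6 * m * (R - 4)) + 1"
    using N D by (auto simp: q_def)
  have to_z: "\<exists>t \<le> q * (12 * m) + 1. (k, z) \<in> edges ^^ t" if k: "k < n" for k
  proof -
    have "N \<le> q * (6 * m * (R - 4))" using q(1) D by (simp add: pos_divide_le_eq)
    then have "\<Phi> k \<le> R - 2 + q * (6 * m * (R - 4))" using \<Phi>_le_N[OF k] R_large by linarith
    from reach_core[OF k this] obtain j t where
      j: "j < n" "t \<le> q * (12 * m)" "(k, j) \<in> edges ^^ t" "\<Phi> j \<le> R - 2" by blast
    show ?thesis
    proof (cases "j = z")
      case True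
      then show ?thesis using j by (intro exI[of _ t]) auto
    next
      case False
      \<comment> \<open>The core radius \<open>R - 2\<close> and the distance of \<open>z\<close>
        from the centre, below 2, add up to at most the range.\<close>
      have "(j, z) \<in> edges"
        using z j False dist_triangle[of "P j" "P z" centre] by (auto simp: edges_def dist_commute)
      then have "(k, z) \<in> edges ^^ Suc t" using j by auto
      then show ?thesis using j by (intro exI[of _ "Suc t"]) auto
    qed
  qed
  have "sym edges" by (auto simp: sym_def edges_def dist_commute)
  obtain s where s: "s \<le> q * (12 * m) + 1" "(i, z) \<in> edges ^^ s" using to_z assms by blast
  obtain t where t: "t \<le> q * (12 * m) + 1" "(j, z) \<in> edges ^^ t" using to_z assms by blast
  have "(z, j) \<in> edges ^^ t" using sym_relpow[OF \<open>sym edges\<close>] t(2) by (meson symD)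
  with s have "(i, j) \<in> edges ^^ (s + t)" by (auto simp: relpow_add)
  moreover have "real (s + t) \<le> 5 * N / R + 24 * m + 2"
  proof -
    have "real (s + t) \<le> real (2 * (q * (12 * m) + 1))"
      unfolding of_nat_le_iff using s t by simp
    also have "\<dots> = 24 * real m * real q + 2" by simp
    also have "24 * real m * real q \<le> 24 * m * (N / (6 * m * (R - 4)) + 1)"
      unfolding of_nat_mult of_nat_numeral using q by (intro mult_left_mono) auto
    also have "\<dots> = 4 * N / (R - 4) + 24 * m" using m_pos R_large by (simp add: field_simps)
    \<comment> \<open>This amounts to \<open>R >= 20\<close>.\<close>
    also have "4 * N / (R - 4) \<le> 5 * N / R"
    proof -
      have "20 * real_of_int N \<le> R * N" using R_large N by (intro mult_right_mono) auto
      then show ?thesis using R_large by (simp add: field_simps)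
    qed
    finally show ?thesis by simp
  qed
  ultimately show ?thesis by blast
qed

end

section \<open>Hop diameter\<close>

text \<open>For \<open>t = 0\<close> the power is the identity on all naturals, so
  \<open>i < n\<close> has to be supplied separately.\<close>

lemma rgg_walk_if_relpow:
  assumes "(i, j) \<in> {(i, j). i < n \<and> j < n \<and> rgg_adj p r i j} ^^ t" "i < n"
  shows "rgg_walk n p r i j t"
proof -
  from assms(1) obtain f where f: "f 0 = i" "f t = j"
      "\<forall>s<t. f s < n \<and> f (Suc s) < n \<and> rgg_adj p r (f s) (f (Suc s))"
    unfolding relpow_fun_conv by auto
  have "f s < n" if "s \<le> t" for s
    using f assms(2) that by (cases s) auto
  moreover have "hd (map f [0..<Suc t]) = i" using f by (simp add: hd_map del: upt_Suc)
  moreover have "last (map f [0..<Suc t]) = j" using f by simp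
  moreover have "rgg_adj p r (map f [0..<Suc t] ! s) (map f [0..<Suc t] ! Suc s)" if "s < t" for s
    using f that by (simp del: upt_Suc)
  ultimately show ?thesis
    unfolding rgg_walk_def
    by (intro exI[of _ "map f [0..<Suc t]"] conjI) (auto simp del: upt_Suc)
qed

lemma hop_diameter_le:
  assumes "\<And>i j. i < n \<Longrightarrow> j < n \<Longrightarrow> \<exists>t. rgg_walk n p r i j t \<and> real t \<le> B" and "0 \<le> B"
  shows "ereal_of_enat (hop_diameter n p r) \<le> ereal B"
proof -
  have "hop_dist n p r i j \<le> enat (nat \<lfloor>B\<rfloor>)" if "i < n" "j < n" for i j
  proof -
    obtain t where t: "rgg_walk n p r i j t" "real t \<le> B" using assms(1) \<open>i < n\<close> \<open>j < n\<close> by blast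
    have "hop_dist n p r i j \<le> enat t" unfolding hop_dist_def using t(1) by (intro INF_lower) auto
    also have "\<dots> \<le> enat (nat \<lfloor>B\<rfloor>)" using t(2) by (simp add: le_nat_floor)
    finally show ?thesis .
  qed
  then have "hop_diameter n p r \<le> enat (nat \<lfloor>B\<rfloor>)"
    unfolding hop_diameter_def by (intro SUP_least) auto
  then have "ereal_of_enat (hop_diameter n p r) \<le> ereal_of_enat (enat (nat \<lfloor>B\<rfloor>))"
    by (simp only: ereal_of_enat_le_iff)
  also have "\<dots> \<le> ereal B" using assms(2) by simp
  finally show ?thesis .
qed

section \<open>Measurability of the diameter event\<close>

lemma hop_diameter_cong:
  assumes "\<And>i j. i < n \<Longrightarrow> j < n \<Longrightarrow> rgg_adj p r i j \<longleftrightarrow> rgg_adj p' r i j"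
  shows "hop_diameter n p r = hop_diameter n p' r"
proof -
  have "(\<forall>m<k. rgg_adj p r (xs ! m) (xs ! Suc m)) \<longleftrightarrow> (\<forall>m<k. rgg_adj p' r (xs ! m) (xs ! Suc m))"
    if "length xs = Suc k" "set xs \<subseteq> {..<n}" for xs k
  proof -
    have "xs ! m < n" if "m \<le> k" for m
    proof -
      have "xs ! m \<in> set xs" using that \<open>length xs = Suc k\<close> by simp
      then show ?thesis using \<open>set xs \<subseteq> {..<n}\<close> by blast
    qed
    then have "xs ! m < n" "xs ! Suc m < n" if "m < k" for m using that by auto
    then show ?thesis using assms by blast
  qed
  then have "rgg_walk n p r i j k \<longleftrightarrow> rgg_walk n p' r i j k" for i j k
    unfolding rgg_walk_def by blast
  then show ?thesis by (simp add: hop_diameter_def hop_dist_def)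
qed

text \<open>The diameter depends only on the adjacency relation, which takes finitely many values.
  The event is thus a finite union of fibres, each cut out by finitely many comparisons of distances
  with \<open>r\<close>.\<close>

lemma sets_hop_diameter_le:
  "{p \<in> space (sensor_space n V). ereal_of_enat (hop_diameter n p r) \<le> B} \<in> sets (sensor_space n V)"
proof -
  let ?M = "sensor_space n V"
  define A where "A p = {(i, j). i < n \<and> j < n \<and> rgg_adj p r i j}" for p
  define Q where "Q p \<longleftrightarrow> ereal_of_enat (hop_diameter n p r) \<le> B" for p
  have "Q p \<longleftrightarrow> Q p'" if "A p = A p'" for p p'
  proof -
    have "hop_diameter n p r = hop_diameter n p' r"
      using that by (intro hop_diameter_cong) (auto simp: A_def set_eq_iff)
    then show ?thesis by (simp add: Q_def)
  qed
  then have "{p \<in> space ?M. Q p} = (\<Union>T\<in>A ` {p. Q p}. {p \<in> space ?M. A p = T})" by blast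
  moreover have "finite (A ` {p. Q p})"
    by (rule finite_subset[of _ "Pow ({..<n} \<times> {..<n})"]) (auto simp: A_def)
  moreover have "{p \<in> space ?M. A p = T} \<in> sets ?M" for T
  proof (cases "T \<subseteq> {..<n} \<times> {..<n}")
    case True
    then have "{p \<in> space ?M. A p = T} =
        {p \<in> space ?M. \<forall>i\<in>{..<n}. \<forall>j\<in>{..<n}. (i, j) \<in> T \<longleftrightarrow> i \<noteq> j \<and> dist (p i) (p j) \<le> r}"
      by (auto simp: A_def rgg_adj_def)
    moreover have "(\<lambda>p. p i) \<in> ?M \<rightarrow>\<^sub>M borel" if "i < n" for i
      using measurable_component_singleton[of i "{..<n}" "\<lambda>_. uniform_measure lborel (cube V)"] that
      by (simp add: sensor_space_def cong: measurable_cong_sets)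
    then have [measurable]: "(\<lambda>p. dist (p i) (p j)) \<in> borel_measurable ?M" if "i < n" "j < n" for i j
      using that by (intro borel_measurable_dist) auto
    have "{p \<in> space ?M. \<forall>i\<in>{..<n}. \<forall>j\<in>{..<n}. (i, j) \<in> T \<longleftrightarrow> i \<noteq> j \<and> dist (p i) (p j) \<le> r} \<in> sets ?M"
      by measurable auto
    ultimately show ?thesis by simp
  next
    case False
    then have "{p \<in> space ?M. A p = T} = {}" by (auto simp: A_def)
    then show ?thesis by (simp only: sets.empty_sets)
  qed
  ultimately have "{p \<in> space ?M. Q p} \<in> sets ?M"
    by (simp only:) (intro sets.finite_UN)
  then show ?thesis by (simp add: Q_def)
qed

section \<open>Probability of large voids\<close>

lemma measure_cube: "0 < V \<Longrightarrow> measure lborel (cube V) = V"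
proof -
  assume "0 < V"
  then have "cube V \<noteq> {}" unfolding cube_def interval_ne_empty_cart by simp
  then show ?thesis using \<open>0 < V\<close> unfolding cube_def by (simp add: content_cbox_cart)
qed

lemma prob_space_cube:
  assumes "0 < V" shows "prob_space (uniform_measure lborel (cube V))"
proof (rule prob_space_uniform_measure)
  show "emeasure lborel (cube V) \<noteq> \<infinity>" by (simp add: cube_def emeasure_lborel_cbox_eq)
  then show "emeasure lborel (cube V) \<noteq> 0" using measure_cube[OF assms] assms
    by (auto simp: measure_def)
qed

lemma prob_space_sensor_space: "0 < V \<Longrightarrow> prob_space (sensor_space n V)"
  unfolding sensor_space_def by (intro prob_space_PiM prob_space_cube)

lemma avoid_region:
  assumes "0 < V" and U: "U \<in> sets borel" "U \<subseteq> cube V"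
  shows "{p \<in> space (sensor_space n V). \<forall>k<n. p k \<notin> U} \<in> sets (sensor_space n V)" (is "?B \<in> _")
    and "measure (sensor_space n V) {p \<in> space (sensor_space n V). \<forall>k<n. p k \<notin> U} = (1 - measure lborel U / V) ^ n"
proof -
  let ?M = "uniform_measure lborel (cube V)"
  interpret M: prob_space ?M using prob_space_cube[OF assms(1)] .
  interpret finite_product_prob_space "\<lambda>_. ?M" "{..<n}"
    by unfold_locales auto
  have B: "?B = (\<Pi>\<^sub>E k\<in>{..<n}. - U)"
    by (auto simp: sensor_space_def space_PiM)
  show "?B \<in> sets (sensor_space n V)"
    unfolding B unfolding sensor_space_def using U by (intro sets_PiM_I_finite) auto
  have "measure (sensor_space n V) ?B = (\<Prod>k\<in>{..<n}. measure ?M (- U))"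
    unfolding B unfolding sensor_space_def using U by (intro prob_times) auto
  also have "measure ?M (- U) = 1 - measure ?M U"
    using M.prob_compl[of U] U by (simp add: Compl_eq_Diff_UNIV)
  also have "measure ?M U = measure lborel U / V"
    using U assms(1) measure_cube[OF assms(1)]
    by (subst measure_uniform_measure) (auto simp: emeasure_eq_measure2 cube_def Int_absorb1)
  finally show "measure (sensor_space n V) ?B = (1 - measure lborel U / V) ^ n" by simp
qed

text \<open>The uniform measure lives on all of \<open>real^3\<close>, so outcomes with nodes
  outside the cube exist; they go into the exceptional event at no cost.\<close>

lemma nodes_in_cube_ae:
  assumes "0 < V"
  shows "{p \<in> space (sensor_space n V). \<exists>k<n. p k \<notin> cube V} \<in> null_sets (sensor_space n V)"
proof -
  let ?M = "uniform_measure lborel (cube V)" and ?S = "sensor_space n V"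
  have "{p \<in> space ?S. p k \<notin> cube V} \<in> null_sets ?S" if "k < n" for k
  proof -
    interpret M: prob_space ?M using prob_space_cube[OF assms(1)] .
    have d: "distr ?S ?M (\<lambda>p. p k) = ?M"
      unfolding sensor_space_def using \<open>k < n\<close> prob_space_cube[OF assms]
      by (intro distr_PiM_component) auto
    have m: "(\<lambda>p. p k) \<in> ?S \<rightarrow>\<^sub>M ?M"
      unfolding sensor_space_def using \<open>k < n\<close> by (intro measurable_component_singleton) auto
    have C: "- cube V \<in> sets ?M" by (auto simp: cube_def)
    have e: "{p \<in> space ?S. p k \<notin> cube V} = (\<lambda>p. p k) -` (- cube V) \<inter> space ?S" by auto
    have "emeasure ?S ((\<lambda>p. p k) -` (- cube V) \<inter> space ?S) = emeasure ?M (- cube V)"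
      using emeasure_distr[OF m C] d by simp
    also have "\<dots> = 0" by (subst emeasure_uniform_measure) (auto simp: cube_def)
    finally show ?thesis using measurable_sets[OF m C] unfolding e by auto
  qed
  then have "(\<Union>k\<in>{..<n}. {p \<in> space ?S. p k \<notin> cube V}) \<in> null_sets ?S" by auto
  also have "(\<Union>k\<in>{..<n}. {p \<in> space ?S. p k \<notin> cube V}) = {p \<in> space ?S. \<exists>k<n. p k \<notin> cube V}" by auto
  finally show ?thesis .
qed

text \<open>\<open>B\<close> says that all nodes avoid the interiors of the cells in
  \<open>S\<close>: a measurable event that contains the void event. Its probability is an
  \<open>n\<close>-th power, estimated by \<open>1 - x <= exp (- x)\<close>.\<close>

lemma void_event:
  fixes N :: int and V :: real
  assumes V: "0 < V" and N: "0 < N" and S: "\<And>q i. q \<in> S \<Longrightarrow> 0 \<le> q i \<and> q i < N" "finite S"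
  shows "\<exists>B \<in> sets (sensor_space n V). measure (sensor_space n V) B \<le> exp (- n * card S / N ^ 3) \<and>
    (\<forall>p \<in> space (sensor_space n V). S \<subseteq> empty_cells n (\<lambda>k. (N / root 3 V) *\<^sub>R p k) N \<longrightarrow> p \<in> B)"
proof -
  define a where "a = root 3 V / N"
  have a: "0 < a" using V N by (simp add: a_def)
  \<comment> \<open>Open boxes are pairwise disjoint, lie in a single cell each, and have the full
    volume \<open>V / N ^ 3\<close>.\<close>
  define Q where "Q q = box (\<chi> i. a * q i) (\<chi> i. a * (q i + 1))" for q :: "3 \<Rightarrow> int"
  have cell: "cell_of ((N / root 3 V) *\<^sub>R x) = q" if "x \<in> Q q" for x q
  proof -
    have "\<lfloor>N / root 3 V * x $ i\<rfloor> = q i" for i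
    proof -
      have "a * q i < x $ i" "x $ i < a * (q i + 1)" using that by (auto simp: Q_def mem_box_cart)
      moreover have "N / root 3 V = 1 / a" using V by (simp add: a_def)
      ultimately show ?thesis using a by (intro floor_unique) (auto simp: field_simps)
    qed
    then show ?thesis by (simp add: cell_of_def)
  qed
  have Q_meas: "measure lborel (Q q) = V / N ^ 3" for q
  proof -
    have "cbox (\<chi> i. a * q i) (\<chi> i. a * (q i + 1)) \<noteq> {}"
      unfolding interval_ne_empty_cart using a by simp
    then have "measure lborel (cbox (\<chi> i. a * q i) (\<chi> i. a * (q i + 1))) = a ^ 3"
      by (simp add: content_cbox_cart algebra_simps power3_eq_cube)
    also have "a ^ 3 = V / N ^ 3" using V by (simp add: a_def power_divide)
    finally show ?thesis by (simp add: Q_def measure_lborel_box_eq measure_lborel_cbox_eq)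
  qed
  have Q_sets: "Q q \<in> sets borel" "emeasure lborel (Q q) \<noteq> \<infinity>" for q
    by (auto simp: Q_def emeasure_lborel_box_eq)
  define U where "U = (\<Union>q\<in>S. Q q)"
  have "disjoint_family_on Q S" using cell by (auto simp: disjoint_family_on_def)
  then have "measure lborel U = (\<Sum>q\<in>S. measure lborel (Q q))"
    unfolding U_def using S Q_sets by (intro measure_finite_Union) auto
  then have U_meas: "measure lborel U = card S * (V / N ^ 3)" by (simp add: Q_meas)
  have U_sets: "U \<in> sets borel" using S by (auto simp: U_def Q_def)
  have U_cube: "U \<subseteq> cube V"
  proof
    fix x assume "x \<in> U"
    then obtain q where q: "q \<in> S" "x \<in> Q q" by (auto simp: U_def)
    have "0 \<le> x $ i \<and> x $ i \<le> root 3 V" for i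
    proof -
      have "a * q i < x $ i" "x $ i < a * (q i + 1)" using q by (auto simp: Q_def mem_box_cart)
      moreover have "0 \<le> a * q i" using a S q by simp
      moreover have "q i + 1 \<le> N" using S(1)[OF q(1), of i] by linarith
      then have "a * (q i + 1) \<le> a * N" using a by (intro mult_left_mono) linarith+
      moreover have "a * N = root 3 V" using N by (simp add: a_def)
      ultimately show ?thesis by linarith
    qed
    then show "x \<in> cube V" by (simp add: cube_def mem_box_cart)
  qed
  note avoid = avoid_region[OF V U_sets U_cube, of n]
  let ?B = "{p \<in> space (sensor_space n V). \<forall>k<n. p k \<notin> U}"
  have "measure lborel U \<le> measure lborel (cube V)"
    using U_sets U_cube by (intro measure_mono_fmeasurable) (auto simp: cube_def)
  then have "0 \<le> 1 - measure lborel U / V" using V by (simp add: measure_cube)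
  moreover have "1 - measure lborel U / V \<le> exp (- (card S / N ^ 3))"
    using exp_ge_add_one_self[of "- (card S / N ^ 3)"] V by (simp add: U_meas)
  ultimately have "measure (sensor_space n V) ?B \<le> exp (- (card S / N ^ 3)) ^ n"
    unfolding avoid(2) by (intro power_mono)
  also have "\<dots> = exp (- n * card S / N ^ 3)" by (simp flip: exp_of_nat_mult)
  finally have "measure (sensor_space n V) ?B \<le> exp (- n * card S / N ^ 3)" .
  moreover have "p \<in> ?B" if "p \<in> space (sensor_space n V)"
    "S \<subseteq> empty_cells n (\<lambda>k. (N / root 3 V) *\<^sub>R p k) N" for p
    using that cell by (fastforce simp: U_def empty_cells_def)
  ultimately show ?thesis using avoid(1) by blast
qed

lemma card_cell_nbhd: "card (cell_nbhd h g) = nat (2 * h + 1) ^ 3"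
  by (simp add: cell_nbhd_eq_PiE card_PiE algebra_simps power3_eq_cube)

text \<open>A special coordinate lies in one of three intervals, with \<open>h + 1\<close>,
  \<open>h + 1\<close> and \<open>2 * h + 2\<close> elements; the others have \<open>N + 1\<close>
  choices.\<close>

lemma card_special_le:
  fixes h N :: int
  assumes "0 \<le> h" "0 < N"
  shows "finite {g. (\<forall>i. 0 \<le> g i \<and> g i \<le> N) \<and> special h N g = A}" (is "finite ?G")
    and "card {g. (\<forall>i. 0 \<le> g i \<and> g i \<le> N) \<and> special h N g = A} \<le> nat (4 * h + 4) ^ card A * nat (N + 1) ^ (3 - card A)"
proof -
  define T where "T = {0..h} \<union> {N - h..N} \<union> {N div 2 - h..N div 2 + h + 1}"
  let ?D = "Pi\<^sub>E UNIV (\<lambda>i::3. if i \<in> A then T else {0..N})"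
  have sub: "?G \<subseteq> ?D"
  proof
    fix g assume g: "g \<in> ?G"
    have "g i \<in> T" if "i \<in> A" for i
    proof -
      have "0 \<le> g i \<and> g i \<le> N" "g i \<le> h \<or> N - h \<le> g i \<or> \<bar>2 * g i - N\<bar> \<le> 2 * h"
        using g that by (auto simp: special_def)
      then show ?thesis unfolding T_def by auto
    qed
    then show "g \<in> ?D" using g by (auto simp: PiE_UNIV_domain)
  qed
  have fin: "finite ?D" by (intro finite_PiE) (auto simp: T_def)
  show "finite ?G" using sub fin by (rule finite_subset)
  have "card T \<le> card {0..h} + card {N - h..N} + card {N div 2 - h..N div 2 + h + 1}"
    unfolding T_def by (meson add_right_mono card_Un_le order_trans)
  also have "\<dots> = nat (4 * h + 4)" using assms by simp
  finally have T: "card T \<le> nat (4 * h + 4)" .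
  have "card ?G \<le> card ?D" using sub fin by (intro card_mono)
  also have "\<dots> = (\<Prod>i\<in>UNIV. if i \<in> A then card T else nat (N + 1))"
    by (simp add: card_PiE if_distrib cong: if_cong)
  also have "\<dots> = card T ^ card A * nat (N + 1) ^ card (- A)"
    by (simp add: prod.If_cases Compl_eq_Diff_UNIV)
  also have "card (- A) = 3 - card A" by (simp add: Compl_eq_Diff_UNIV card_Diff_subset)
  also have "card T ^ card A * nat (N + 1) ^ (3 - card A) \<le> nat (4 * h + 4) ^ card A * nat (N + 1) ^ (3 - card A)"
    using T by (intro mult_right_mono power_mono) auto
  finally show "card ?G \<le> nat (4 * h + 4) ^ card A * nat (N + 1) ^ (3 - card A)" .
qed

text \<open>A union bound over the cells \<open>g\<close> and over the sets of exactly quota many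
  cells near \<open>g\<close>. The number of such sets is bounded in terms of \<open>h\<close>
  alone; the cells are grouped by their special coordinates, which determine the quota.\<close>

lemma sparse_voids_event:
  fixes N h :: int and V :: real
  assumes V: "0 < V" and N: "0 < N" and h: "0 \<le> h"
  shows "\<exists>B \<in> sets (sensor_space n V). measure (sensor_space n V) B \<le> 2 ^ (nat (2 * h + 1) ^ 3) *
      (\<Sum>A\<in>UNIV. real (nat (4 * h + 4)) ^ card A * real_of_int (N + 1) ^ (3 - card A) *
        exp (- n * quota m (card (A :: 3 set)) / N ^ 3)) \<and>
    (\<forall>p \<in> space (sensor_space n V) - B.
      (\<forall>k<n. \<forall>i. 0 \<le> ((N / root 3 V) *\<^sub>R p k) $ i \<and> ((N / root 3 V) *\<^sub>R p k) $ i \<le> N) \<and>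
      (\<forall>g. (\<forall>i. 0 \<le> g i \<and> g i \<le> N) \<longrightarrow>
        card (empty_cells n (\<lambda>k. (N / root 3 V) *\<^sub>R p k) N \<inter> cell_nbhd h g) < quota m (card (special h N g))))"
proof -
  let ?M = "sensor_space n V"
  let ?E = "\<lambda>p. empty_cells n (\<lambda>k. (N / root 3 V) *\<^sub>R p k) N"
  let ?C = "2 ^ (nat (2 * h + 1) ^ 3) :: real"
  interpret prob_space ?M using V by (rule prob_space_sensor_space)
  define G where "G = {g :: 3 \<Rightarrow> int. \<forall>i. 0 \<le> g i \<and> g i \<le> N}"
  define I where "I g = {S. S \<subseteq> cell_nbhd h g \<inter> {q. \<forall>i. 0 \<le> q i \<and> q i < N} \<and> card S = quota m (card (special h N g))}" for g
  define w where "w A = exp (- n * quota m (card A) / N ^ 3)" for A :: "3 set"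
  have fin_I: "finite (I g)" and card_I: "card (I g) \<le> ?C" for g
  proof -
    have sub: "I g \<subseteq> Pow (cell_nbhd h g)" by (auto simp: I_def)
    then show "finite (I g)" by (rule finite_subset) simp
    have "card (I g) \<le> card (Pow (cell_nbhd h g))" using sub by (intro card_mono) auto
    also have "\<dots> = 2 ^ (nat (2 * h + 1) ^ 3)" by (simp add: card_Pow card_cell_nbhd)
    finally show "card (I g) \<le> ?C" by (metis of_nat_le_iff of_nat_numeral of_nat_power)
  qed
  have G_part: "G = (\<Union>A\<in>UNIV. {g. (\<forall>i. 0 \<le> g i \<and> g i \<le> N) \<and> special h N g = A})" by (auto simp: G_def)
  have fin_G: "finite G" unfolding G_part using card_special_le(1)[OF h N] by (intro finite_UN_I) auto
  \<comment> \<open>The event is chosen from \<open>S\<close> alone. Its bound equals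
    \<open>w\<close> for every \<open>g\<close> with \<open>S\<close> in \<open>I g\<close>, as
    \<open>card S\<close> is then the quota of \<open>g\<close>.\<close>
  have "\<exists>B. \<forall>g. \<forall>S\<in>I g. B S \<in> sets ?M \<and> prob (B S) \<le> w (special h N g) \<and>
      (\<forall>p \<in> space ?M. S \<subseteq> ?E p \<longrightarrow> p \<in> B S)"
  proof -
    have "\<exists>b. b \<in> sets ?M \<and> prob b \<le> exp (- n * card S / N ^ 3) \<and> (\<forall>p \<in> space ?M. S \<subseteq> ?E p \<longrightarrow> p \<in> b)"
      if "S \<in> (\<Union>g. I g)" for S
    proof -
      from that obtain g where "S \<subseteq> cell_nbhd h g" "\<And>q i. q \<in> S \<Longrightarrow> 0 \<le> q i \<and> q i < N"
        by (fastforce simp: I_def)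
      then show ?thesis using void_event[OF V N, of S n] finite_subset[OF _ finite_cell_nbhd] by blast
    qed
    then obtain B where "\<And>S. S \<in> (\<Union>g. I g) \<Longrightarrow> B S \<in> sets ?M \<and> prob (B S) \<le> exp (- n * card S / N ^ 3) \<and>
        (\<forall>p \<in> space ?M. S \<subseteq> ?E p \<longrightarrow> p \<in> B S)" by metis
    moreover have "exp (- n * card S / N ^ 3) = w (special h N g)" if "S \<in> I g" for S g
      using that by (simp add: I_def w_def)
    ultimately show ?thesis by (intro exI[of _ B]) fastforce
  qed
  then obtain Bv where Bv_all: "\<forall>g. \<forall>S\<in>I g. Bv S \<in> sets ?M \<and> prob (Bv S) \<le> w (special h N g) \<and>
      (\<forall>p \<in> space ?M. S \<subseteq> ?E p \<longrightarrow> p \<in> Bv S)" by (rule exE)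
  have Bv: "\<And>g S. S \<in> I g \<Longrightarrow> Bv S \<in> sets ?M" "\<And>g S. S \<in> I g \<Longrightarrow> prob (Bv S) \<le> w (special h N g)"
      "\<And>g S p. S \<in> I g \<Longrightarrow> p \<in> space ?M \<Longrightarrow> S \<subseteq> ?E p \<Longrightarrow> p \<in> Bv S"
    using Bv_all by simp_all
  define Z where "Z = {p \<in> space ?M. \<exists>k<n. p k \<notin> cube V}"
  have Z: "Z \<in> sets ?M" "prob Z = 0"
    using nodes_in_cube_ae[OF V, of n] unfolding Z_def[symmetric]
    by (auto dest: null_setsD2 measure_eq_0_null_sets)
  define B where "B = Z \<union> (\<Union>g\<in>G. \<Union>S\<in>I g. Bv S)"
  have inner_sets: "(\<Union>S\<in>I g. Bv S) \<in> sets ?M" for g using fin_I Bv(1) by (intro sets.finite_UN) auto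
  then have outer_sets: "(\<Union>g\<in>G. \<Union>S\<in>I g. Bv S) \<in> sets ?M"
    using fin_G by (rule sets.finite_UN[rotated])
  have "prob B \<le> prob Z + prob (\<Union>g\<in>G. \<Union>S\<in>I g. Bv S)"
    unfolding B_def using Z outer_sets by (intro measure_Un_le)
  also have "\<dots> \<le> (\<Sum>g\<in>G. prob (\<Union>S\<in>I g. Bv S))"
    using Z fin_G inner_sets by (simp add: measure_UNION_le)
  also have "\<dots> \<le> (\<Sum>g\<in>G. ?C * w (special h N g))"
  proof (rule sum_mono)
    fix g
    have "prob (\<Union>S\<in>I g. Bv S) \<le> (\<Sum>S\<in>I g. prob (Bv S))"
      using fin_I Bv(1) by (intro measure_UNION_le) auto
    also have "\<dots> \<le> (\<Sum>S\<in>I g. w (special h N g))" using Bv(2) by (intro sum_mono)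
    also have "\<dots> = card (I g) * w (special h N g)" by simp
    also have "\<dots> \<le> ?C * w (special h N g)" using card_I by (intro mult_right_mono) (auto simp: w_def)
    finally show "prob (\<Union>S\<in>I g. Bv S) \<le> ?C * w (special h N g)" .
  qed
  also have "\<dots> = ?C * (\<Sum>g\<in>G. w (special h N g))" by (simp add: sum_distrib_left)
  also have "(\<Sum>g\<in>G. w (special h N g)) = (\<Sum>A\<in>UNIV. \<Sum>g\<in>{g \<in> G. special h N g = A}. w (special h N g))"
    using fin_G by (intro sum.group[symmetric]) auto
  also have "\<dots> \<le> (\<Sum>A\<in>UNIV. real (nat (4 * h + 4)) ^ card A * real_of_int (N + 1) ^ (3 - card A) * w A)"
  proof (rule sum_mono)
    fix A :: "3 set"
    have "(\<Sum>g\<in>{g \<in> G. special h N g = A}. w (special h N g)) = card {g \<in> G. special h N g = A} * w A"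
      by simp
    also have "\<dots> \<le> real (nat (4 * h + 4) ^ card A * nat (N + 1) ^ (3 - card A)) * w A"
      using card_special_le(2)[OF h N, of A]
      by (intro mult_right_mono) (auto simp: w_def G_def simp del: of_nat_mult of_nat_power)
    also have "real (nat (4 * h + 4) ^ card A * nat (N + 1) ^ (3 - card A)) =
        real (nat (4 * h + 4)) ^ card A * real_of_int (N + 1) ^ (3 - card A)"
      using N by simp
    finally show "(\<Sum>g\<in>{g \<in> G. special h N g = A}. w (special h N g)) \<le>
        real (nat (4 * h + 4)) ^ card A * real_of_int (N + 1) ^ (3 - card A) * w A" .
  qed
  finally have bound: "prob B \<le> ?C * (\<Sum>A\<in>UNIV. real (nat (4 * h + 4)) ^ card A * real_of_int (N + 1) ^ (3 - card A) * w A)"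
    by simp
  have cube: "0 \<le> ((N / root 3 V) *\<^sub>R p k) $ i \<and> ((N / root 3 V) *\<^sub>R p k) $ i \<le> N"
    if "p \<in> space ?M - B" "k < n" for p k i
  proof -
    have "p k \<in> cube V" using that by (auto simp: B_def Z_def)
    then have "0 \<le> p k $ i" "p k $ i \<le> root 3 V" by (auto simp: cube_def mem_box_cart)
    then show ?thesis using V N by (simp add: field_simps)
  qed
  have sparse: "card (?E p \<inter> cell_nbhd h g) < quota m (card (special h N g))"
    if p: "p \<in> space ?M - B" and g: "\<forall>i. 0 \<le> g i \<and> g i \<le> N" for p g
  proof (rule ccontr)
    assume "\<not> ?thesis"
    then obtain S where S: "S \<subseteq> ?E p \<inter> cell_nbhd h g" "card S = quota m (card (special h N g))"
      by (meson not_less obtain_subset_with_card_n)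
    then have "S \<in> I g" by (auto simp: I_def empty_cells_def)
    with S Bv(3) p have "p \<in> Bv S" by blast
    then show False using p g \<open>S \<in> I g\<close> by (auto simp: B_def G_def)
  qed
  have "B \<in> sets ?M" unfolding B_def using Z outer_sets by blast
  then show ?thesis using bound cube sparse unfolding w_def by blast
qed

section \<open>Asymptotics\<close>

context
  fixes m :: nat
  assumes m_pos: "0 < m"
begin

text \<open>Before rounding, \<open>exp (- n / side n ^ 3)\<close> is
  \<open>n powr (- 1 / (3 * m))\<close>, the rate at which a single cell is empty.\<close>

definition side :: "nat \<Rightarrow> real" where
  "side n = root 3 (3 * m * n / ln n)"

definition cells_per_side :: "nat \<Rightarrow> int" where
  "cells_per_side n = \<lfloor>side n\<rfloor>"

lemma side_cube: "1 < n \<Longrightarrow> side n ^ 3 = 3 * m * n / ln n"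
  by (simp add: side_def)

lemma side_at_top: "filterlim side at_top sequentially"
  unfolding side_def using m_pos by real_asymp

lemma cells_per_side_bounds: "side n - 1 < cells_per_side n" "cells_per_side n \<le> side n"
  by (auto simp: cells_per_side_def)

lemma eventually_cells_per_side_ge: "\<forall>\<^sub>F n in sequentially. C \<le> real_of_int (cells_per_side n)"
proof -
  have "\<forall>\<^sub>F n in sequentially. C + 1 \<le> side n"
    using side_at_top by (auto simp: filterlim_at_top)
  then show ?thesis
  proof eventually_elim
    case (elim n)
    then show ?case using cells_per_side_bounds(1)[of n] by linarith
  qed
qed

lemma cells_per_side_ratio: "(\<lambda>n. cells_per_side n / side n) \<longlonglongrightarrow> 1"
proof (rule tendsto_sandwich)
  have "(\<lambda>n. 1 - inverse (side n)) \<longlonglongrightarrow> 1 - 0"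
    by (intro tendsto_diff tendsto_const tendsto_inverse_0_at_top side_at_top)
  then show "(\<lambda>n. 1 - inverse (side n)) \<longlonglongrightarrow> 1" by simp
  have pos: "\<forall>\<^sub>F n in sequentially. 0 < side n"
    using side_at_top by (auto simp: filterlim_at_top_dense)
  show "\<forall>\<^sub>F n in sequentially. 1 - inverse (side n) \<le> cells_per_side n / side n"
    using pos
  proof eventually_elim
    case (elim n)
    then have "(side n - 1) / side n \<le> cells_per_side n / side n"
      using cells_per_side_bounds(1)[of n] by (intro divide_right_mono) auto
    then show ?case using elim by (simp add: diff_divide_distrib inverse_eq_divide)
  qed
  show "\<forall>\<^sub>F n in sequentially. cells_per_side n / side n \<le> 1"
    using pos
  proof eventually_elim
    case (elim n)
    then show ?case using cells_per_side_bounds(2)[of n] by simp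
  qed
qed simp

text \<open>Rounding down makes the cells larger, so the expected number of nodes per cell can only
  grow.\<close>

lemma n_over_cells_ge:
  assumes "1 < n" "0 < cells_per_side n"
  shows "ln n / (3 * m) \<le> n / real_of_int (cells_per_side n) ^ 3"
proof -
  have "real_of_int (cells_per_side n) ^ 3 \<le> side n ^ 3"
    using assms cells_per_side_bounds(2)[of n] by (intro power_mono) auto
  then have "real_of_int (cells_per_side n) ^ 3 \<le> 3 * m * n / ln n"
    using side_cube assms by simp
  then show ?thesis using assms m_pos by (simp add: field_simps)
qed

text \<open>For \<open>k < 3\<close> special coordinates the summand is a constant times the power
  \<open>3 - k\<close> of one null sequence, \<open>d\<close>; for \<open>k = 3\<close> the quota is
  1 and the exponential alone, \<open>e\<close>, tends to 0.\<close>

lemma failure_bound_tendsto_0: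
  "(\<lambda>n. K * (\<Sum>A\<in>UNIV. C ^ card A * real_of_int (cells_per_side n + 1) ^ (3 - card A) *
      exp (- n * quota m (card (A :: 3 set)) / cells_per_side n ^ 3))) \<longlonglongrightarrow> 0"
proof -
  let ?N = "\<lambda>n. real_of_int (cells_per_side n)"
  have ev: "\<forall>\<^sub>F n in sequentially. 1 < n \<and> 0 < cells_per_side n"
    using eventually_cells_per_side_ge[of 1] eventually_gt_at_top[of 1] by eventually_elim simp
  have d: "(\<lambda>n. (?N n + 1) * exp (- real n * m / ?N n ^ 3)) \<longlonglongrightarrow> 0"
  proof (rule tendsto_sandwich[of "\<lambda>_. 0"])
    \<comment> \<open>Here \<open>side n\<close> is of order \<open>root 3 (n / ln n)\<close> and
      the exponential is \<open>n powr (- 1 / 3)\<close>, so only the logarithm brings the product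
      to 0.\<close>
    show "(\<lambda>n. (side n + 1) * exp (- ln n / 3)) \<longlonglongrightarrow> 0"
      unfolding side_def using m_pos by real_asymp
    show "\<forall>\<^sub>F n in sequentially. (?N n + 1) * exp (- real n * m / ?N n ^ 3) \<le> (side n + 1) * exp (- ln n / 3)"
      using ev
    proof eventually_elim
      case (elim n)
      have "ln n / 3 \<le> real n * m / ?N n ^ 3"
        using mult_left_mono[OF n_over_cells_ge, of n "real m"] elim m_pos by (simp add: field_simps)
      then show ?case using elim cells_per_side_bounds(2)[of n]
        by (intro mult_mono) auto
    qed
    show "\<forall>\<^sub>F n in sequentially. 0 \<le> (?N n + 1) * exp (- real n * m / ?N n ^ 3)"
      using ev by eventually_elim simp
  qed simp
  have e: "(\<lambda>n. exp (- real n / ?N n ^ 3)) \<longlonglongrightarrow> 0"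
  proof (rule tendsto_sandwich[of "\<lambda>_. 0"])
    show "(\<lambda>n. exp (- (ln (real n) / (3 * m)))) \<longlonglongrightarrow> 0" using m_pos by real_asymp
    show "\<forall>\<^sub>F n in sequentially. exp (- real n / ?N n ^ 3) \<le> exp (- (ln n / (3 * m)))"
      using ev by eventually_elim (use n_over_cells_ge in auto)
  qed auto
  have "(\<lambda>n. C ^ card A * real_of_int (cells_per_side n + 1) ^ (3 - card A) *
      exp (- n * quota m (card A) / cells_per_side n ^ 3)) \<longlonglongrightarrow> 0" for A :: "3 set"
  proof (cases "card A = 3")
    case True
    then show ?thesis using tendsto_mult_right_zero[OF e, of "C ^ 3"] by (simp add: quota_def)
  next
    case False
    moreover have "card A \<le> card (UNIV :: 3 set)" by (intro card_mono) auto
    ultimately have k: "0 < 3 - card A" by simp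
    have "(\<lambda>n. C ^ card A * ((?N n + 1) * exp (- real n * m / ?N n ^ 3)) ^ (3 - card A)) \<longlonglongrightarrow> C ^ card A * 0 ^ (3 - card A)"
      by (intro tendsto_intros d)
    moreover have exp_power: "exp (- real n * m / ?N n ^ 3) ^ (3 - card A) = exp (- n * quota m (card A) / cells_per_side n ^ 3)" for n
    proof -
      have "real (quota m (card A)) = real (3 - card A) * real m" using False by (simp add: quota_def)
      then show ?thesis by (simp add: mult_ac flip: exp_of_nat_mult)
    qed
    ultimately show ?thesis
      unfolding power_mult_distrib exp_power using k by (simp only: mult.assoc of_int_add of_int_1 zero_power mult_zero_right)
  qed
  then have "(\<lambda>n. K * (\<Sum>A\<in>UNIV. C ^ card A * real_of_int (cells_per_side n + 1) ^ (3 - card A) *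
      exp (- n * quota m (card (A :: 3 set)) / cells_per_side n ^ 3))) \<longlonglongrightarrow> K * (\<Sum>A\<in>(UNIV :: 3 set set). 0)"
    by (intro tendsto_mult tendsto_const tendsto_sum)
  then show ?thesis by simp
qed

end

section \<open>Rescaling to the original cube and passing to the limit\<close>

lemma hop_diameter_le_if_sparse:
  fixes N h :: int and s r :: real
  assumes "0 < s" "0 < N"
    and "sparse_voids n m h N (\<lambda>k. (N / s) *\<^sub>R p k) (N / s * r)"
    and B: "5 * s / r + 24 * m + 2 \<le> B"
  shows "ereal_of_enat (hop_diameter n p r) \<le> ereal B"
proof (rule hop_diameter_le)
  interpret sparse_voids n m h N "\<lambda>k. (N / s) *\<^sub>R p k" "N / s * r" by fact
  have c: "0 < N / s" using assms by simp
  have "0 < N / s * r" using R_large by linarith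
  then have r: "0 < r" using c by (rule zero_less_mult_pos)
  have dist_scale: "dist (a *\<^sub>R x) (a *\<^sub>R y) \<le> a * r \<longleftrightarrow> dist x y \<le> r" if "0 < a" for a and x y :: "real^3"
    using that by (simp add: dist_norm flip: scaleR_diff_right)
  have edges_eq: "edges = {(i, j). i < n \<and> j < n \<and> rgg_adj p r i j}"
    unfolding edges_def rgg_adj_def dist_scale[OF c] ..
  have NR: "5 * N / (N / s * r) = 5 * s / r" using assms by (simp add: field_simps)
  show "\<exists>t. rgg_walk n p r i j t \<and> real t \<le> B" if "i < n" "j < n" for i j
  proof -
    obtain t where t: "(i, j) \<in> edges ^^ t" "t \<le> 5 * N / (N / s * r) + 24 * m + 2"
      using short_walk[OF \<open>i < n\<close> \<open>j < n\<close>] by blast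
    have "rgg_walk n p r i j t" using t(1) \<open>i < n\<close> unfolding edges_eq by (rule rgg_walk_if_relpow)
    moreover have "real t \<le> B" using t(2) B unfolding NR by simp
    ultimately show ?thesis by blast
  qed
  show "0 \<le> B" using B r assms(1) by (smt (verit) divide_nonneg_pos of_nat_0_le_iff)
qed

theorem theorem4:
  fixes l \<rho> :: real and V :: "nat \<Rightarrow> real"
  assumes "l > 11/5"
    and "\<And>n. V n > 0"
    and "\<rho> > 0"
    and "(\<lambda>n. real n / V n) \<longlonglongrightarrow> \<rho>"
  shows "(\<lambda>n. measure (sensor_space n (V n))
            {p \<in> space (sensor_space n (V n)).
               ereal_of_enat (hop_diameter n p (r_trans l n (V n)))
                 \<le> ereal (12 * root 3 (pi * real n / (6 * (1 + l) * ln (real n))))})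
         \<longlonglongrightarrow> 1"
proof -
  \<comment> \<open>As \<open>pi < 4\<close>, the bound
    \<open>48 / 5 * m < 4 / 3 * pi * R ^ 3\<close> gives \<open>R ^ 3 >= 9 / 5 * 10 ^ 9\<close>,
    hence \<open>R >= 1000\<close>.\<close>
  obtain m :: nat where m: "10 ^ 9 \<le> m" by blast
  then have m_pos: "0 < m" by (meson less_le_trans zero_less_numeral zero_less_power)
  define L where "L = 1 + l"
  have L: "16 / 5 < L" using assms(1) by (simp add: L_def)
  define N where "N = cells_per_side m"
  define s where "s n = root 3 (V n)" for n
  define r where "r n = r_trans l n (V n)" for n
  define R where "R n = N n / s n * r n" for n
  \<comment> \<open>A bound on \<open>R n\<close> free of \<open>n\<close>, through
    \<open>R <= R ^ 3 <= 4 / 3 * pi * R ^ 3 <= 3 * m * L\<close>. It makes \<open>h\<close> a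
    constant, so the factors in the union bound that depend on \<open>h\<close> are constants
    too.\<close>
  define R1 where "R1 = 3 * m * L"
  define h where "h = \<lceil>(12 * real m + 2) * R1 + 2\<rceil> + \<lceil>R1\<^sup>2 + 2\<rceil>"
  define bound where "bound n = 12 * root 3 (pi * real n / (6 * (1 + l) * ln (real n)))" for n
  have m1: "1 \<le> real m" using m_pos by simp
  have "1 * 1 \<le> real m * (3 * L)" using m1 L by (intro mult_mono) auto
  then have R1: "1 \<le> R1" by (simp add: R1_def algebra_simps)
  then have "0 \<le> (12 * real m + 2) * R1" by simp
  then have h: "(12 * real m + 2) * R1 + 2 \<le> h" "R1\<^sup>2 + 2 \<le> h" "0 \<le> h"
    using zero_le_power2[of R1] unfolding h_def by linarith+
  have s: "0 < s n" "s n ^ 3 = V n" for n using assms(2)[of n] by (auto simp: s_def)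
  \<comment> \<open>By \<open>R3\<close> below, this is the volume of a ball of radius
    \<open>R n\<close>. Because \<open>L > 16 / 5\<close> is strict, \<open>vol\<close> survives the
    rounding of \<open>side\<close> for large \<open>n\<close>.\<close>
  have "(\<lambda>n. 3 * m * L * (N n / side m n) ^ 3) \<longlonglongrightarrow> 3 * m * L * 1 ^ 3"
    unfolding N_def by (intro tendsto_intros cells_per_side_ratio m_pos)
  moreover have "48 / 5 * m < 3 * m * L * 1 ^ 3" using L m_pos by simp
  ultimately have "\<forall>\<^sub>F n in sequentially. 48 / 5 * m < 3 * m * L * (N n / side m n) ^ 3"
    by (rule order_tendstoD)
  \<comment> \<open>The first summand gives \<open>4 * R n <= N n\<close>; the second lets the
    constant \<open>24 * m + 2\<close> be absorbed.\<close>
  moreover have "\<forall>\<^sub>F n in sequentially. 4 * R1 + (24 * m + 2) * R1 \<le> N n"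
    unfolding N_def by (rule eventually_cells_per_side_ge[OF m_pos])
  ultimately have ev: "\<forall>\<^sub>F n in sequentially. 1 < n \<and> 0 < N n \<and> 1000 \<le> R n \<and> R n \<le> R1 \<and>
      48 / 5 * m \<le> 4 / 3 * pi * R n ^ 3 \<and> 4 * R n \<le> N n \<and> 5 * s n / r n + 24 * m + 2 \<le> bound n"
    using eventually_gt_at_top[of 1]
  proof eventually_elim
    case (elim n)
    have ln: "0 < ln (real n)" using elim by simp
    have N1: "1 \<le> real_of_int (N n)" using elim(2) R1 mult_nonneg_nonneg[of "24 * m + 2" R1] by linarith
    have r3: "r n ^ 3 = 3 * L * ln n * V n / (4 * pi * n)" using ln L assms(2)[of n]
      by (simp add: r_def r_trans_def L_def)
    have rpos: "0 < r n" using ln L assms(2)[of n] elim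
      by (simp add: r_def r_trans_def L_def)
    have R3: "4 / 3 * pi * R n ^ 3 = 3 * m * L * (N n / side m n) ^ 3"
    proof -
      have "R n ^ 3 = N n ^ 3 / V n * r n ^ 3" by (simp add: R_def power_mult_distrib power_divide s)
      also have "\<dots> = N n ^ 3 * (3 * L * ln n / (4 * pi * n))" using assms(2)[of n] by (simp add: r3)
      finally show ?thesis using ln m_pos elim
        by (simp add: power_divide side_cube[OF m_pos] field_simps)
    qed
    have Rpos: "0 < R n" using N1 s rpos by (simp add: R_def)
    have "4 / 3 * pi * R n ^ 3 \<le> 16 / 3 * R n ^ 3"
      using pi_less_4 Rpos by (intro mult_right_mono) auto
    with elim(1) have "48 / 5 * real m < 16 / 3 * R n ^ 3" unfolding R3[symmetric] by (rule less_le_trans)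
    moreover have "10 ^ 9 \<le> real m" using m by (metis of_nat_le_iff of_nat_numeral of_nat_power)
    ultimately have "1000 ^ 3 \<le> R n ^ 3" by simp
    then have R1000: "1000 \<le> R n" using Rpos by (meson less_imp_le power_mono_iff zero_less_numeral)
    have "R n \<le> R n ^ 3" using R1000 by (intro self_le_power) auto
    also have "R n ^ 3 \<le> 4 / 3 * pi * R n ^ 3" using pi_gt3 Rpos by simp
    also have "\<dots> \<le> R1"
    proof -
      have "0 < side m n" using cells_per_side_bounds(2)[OF m_pos, of n] N1 by (simp add: N_def)
      then have "(N n / side m n) ^ 3 \<le> 1" using N1 cells_per_side_bounds(2)[OF m_pos, of n]
        by (intro power_le_one) (auto simp: N_def)
      then show ?thesis unfolding R3 R1_def using L m_pos by (simp add: mult_left_le)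
    qed
    finally have RR1: "R n \<le> R1" .
    have N_big: "4 * R n \<le> N n" "(24 * m + 2) * R n \<le> N n"
    proof -
      have "(24 * m + 2) * R n \<le> (24 * m + 2) * R1" using RR1 by (intro mult_left_mono) auto
      moreover have "0 \<le> (24 * m + 2) * R n" using Rpos by simp
      ultimately show "4 * R n \<le> N n" "(24 * m + 2) * R n \<le> N n" using elim(2) R1 RR1 by linarith+
    qed
    \<comment> \<open>The cube of \<open>s n / r n\<close> is 8 times the radicand of
      \<open>bound n\<close>, so 12 splits as \<open>6 * 2\<close>.\<close>
    have "bound n = 6 * (s n / r n)"
    proof -
      have "(s n / r n) ^ 3 = 2 ^ 3 * (pi * n / (6 * L * ln n))"
        using ln L assms(2)[of n] elim by (simp add: power_divide s r3 field_simps)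
      then have "s n / r n = root 3 (2 ^ 3 * (pi * n / (6 * L * ln n)))"
        using s rpos by (metis divide_nonneg_nonneg less_imp_le real_root_power_cancel zero_less_numeral)
      also have "\<dots> = 2 * root 3 (pi * n / (6 * L * ln n))"
        by (simp only: real_root_mult) (simp add: real_root_power_cancel)
      finally show ?thesis by (simp add: bound_def L_def)
    qed
    \<comment> \<open>The sixth multiple of \<open>s n / r n\<close> in \<open>bound n\<close> pays
      for the additive constant next to \<open>5 * s n / r n\<close>.\<close>
    moreover have "24 * m + 2 \<le> s n / r n"
    proof -
      have "(24 * m + 2) * (r n / s n) * N n \<le> 1 * real_of_int (N n)" using N_big(2) by (simp add: R_def algebra_simps)
      then have "(24 * m + 2) * (r n / s n) \<le> 1" using N1 by (subst (asm) mult_le_cancel_right_pos) auto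
      then show ?thesis using rpos s(1)[of n] by (simp add: field_simps)
    qed
    ultimately have "5 * s n / r n + 24 * m + 2 \<le> bound n" by simp
    then show ?case using elim N1 R1000 RR1 R3 N_big by simp
  qed
  define err where "err n = 2 ^ (nat (2 * h + 1) ^ 3) *
      (\<Sum>A\<in>UNIV. real (nat (4 * h + 4)) ^ card A * real_of_int (N n + 1) ^ (3 - card A) *
        exp (- n * quota m (card (A :: 3 set)) / N n ^ 3))" for n
  have "err \<longlonglongrightarrow> 0" unfolding err_def N_def by (rule failure_bound_tendsto_0[OF m_pos])
  then have "(\<lambda>n. 1 - err n) \<longlonglongrightarrow> 1 - 0" by (intro tendsto_intros)
  then have lower: "(\<lambda>n. 1 - err n) \<longlonglongrightarrow> 1" by simp
  let ?G = "\<lambda>n. {p \<in> space (sensor_space n (V n)). ereal_of_enat (hop_diameter n p (r n)) \<le> ereal (bound n)}"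
  \<comment> \<open>Outside the exceptional event \<open>B\<close> the void hypotheses hold and the
    deterministic bound applies.\<close>
  have "\<forall>\<^sub>F n in sequentially. 1 - err n \<le> measure (sensor_space n (V n)) (?G n)"
    using ev
  proof eventually_elim
    case (elim n)
    interpret prob_space "sensor_space n (V n)" by (rule prob_space_sensor_space[OF assms(2)])
    obtain B where B: "B \<in> events" "prob B \<le> err n"
      "\<And>p. p \<in> space (sensor_space n (V n)) - B \<Longrightarrow>
        (\<forall>k<n. \<forall>i. 0 \<le> ((N n / s n) *\<^sub>R p k) $ i \<and> ((N n / s n) *\<^sub>R p k) $ i \<le> N n) \<and>
        (\<forall>g. (\<forall>i. 0 \<le> g i \<and> g i \<le> N n) \<longrightarrow>
          card (empty_cells n (\<lambda>k. (N n / s n) *\<^sub>R p k) (N n) \<inter> cell_nbhd h g) < quota m (card (special h (N n) g)))"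
      using sparse_voids_event[OF assms(2)[of n] _ h(3), of "N n" n m] elim unfolding err_def s_def by blast
    have Rh: "(12 * real m + 2) * R n + 2 \<le> h" "(R n)\<^sup>2 + 2 \<le> h"
    proof -
      have "(12 * real m + 2) * R n \<le> (12 * real m + 2) * R1" using elim by (intro mult_left_mono) auto
      then show "(12 * real m + 2) * R n + 2 \<le> h" using h by linarith
      have "(R n)\<^sup>2 \<le> R1\<^sup>2" using elim by (intro power_mono) auto
      then show "(R n)\<^sup>2 + 2 \<le> h" using h by linarith
    qed
    have "space (sensor_space n (V n)) - B \<subseteq> ?G n"
    proof
      fix p assume p: "p \<in> space (sensor_space n (V n)) - B"
      have sparse: "sparse_voids n m h (N n) (\<lambda>k. (N n / s n) *\<^sub>R p k) (N n / s n * r n)"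
        using B(3)[OF p] elim Rh m_pos by unfold_locales (auto simp: R_def)
      have "ereal_of_enat (hop_diameter n p (r n)) \<le> ereal (bound n)"
        by (rule hop_diameter_le_if_sparse[OF s(1) _ sparse]) (use elim in auto)
      then show "p \<in> ?G n" using p by simp
    qed
    then have "prob (space (sensor_space n (V n)) - B) \<le> prob (?G n)"
      by (intro finite_measure_mono sets_hop_diameter_le)
    then show ?case using B prob_compl[of B] by simp
  qed
  moreover have "measure (sensor_space n (V n)) (?G n) \<le> 1" for n
    by (rule prob_space.prob_le_1[OF prob_space_sensor_space[OF assms(2)]])
  ultimately have "(\<lambda>n. measure (sensor_space n (V n)) (?G n)) \<longlonglongrightarrow> 1"
    by (intro tendsto_sandwich[OF _ _ lower tendsto_const]) auto
  then show ?thesis by (simp only: r_def bound_def)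
qed

end
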